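(* Let $w=w(x_1,\ldots,x_r)$ be an outer commutator word. If $u_1,\ldots,u_r$ are non-commutator words in pairwise disjoint sets of variables, then the word $w(u_1,\ldots,u_r)$ is concise. In particular, the word $w(x_1^{n_1},\ldots,x_r^{n_r})$ is concise whenever $n_1,\ldots,n_r\in\mathbb{Z}\smallsetminus\{0\}$.
   Context: Outer commutator words are defined recursively: every single variable is an outer commutator word, and if $\alpha$ and $\beta$ are outer commutator words involving disjoint sets of variables, then $[\alpha,\beta]$ is an outer commutator word. Writing $w=w(x_1,\ldots,x_r)$ means that $w$ involves exactly the variables $x_1,\ldots,x_r$. A non-commutator word is a word of the free group of infinite rank not lying in its derived subgroup, i.e. a word whose exponent sum in at least one variable is nonzero. For a word $v$ and a group $G$, $v\{G\}$ denotes the set of all values of $v$ in $G$ and $v(G)$ the subgroup generated by $v\{G\}$. A word $v$ is concise if for every group $G$ such that $v\{G\}$ is finite, the subgroup $v(G)$ is also finite. *)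

theory Defs
  imports "HOL-Algebra.Algebra"
begin

text \<open>Group words: elements of the free group on countably many variables x_0, x_1, ...,
  represented by (not necessarily reduced) lists of letters (i, e) meaning x_i if e = False
  and x_i^{-1} if e = True.\<close>
type_synonym word = "(nat \<times> bool) list"

definition word_inv :: "word \<Rightarrow> word" where
  "word_inv w = rev (map (\<lambda>(x, e). (x, \<not> e)) w)"

definition word_comm :: "word \<Rightarrow> word \<Rightarrow> word" where
  "word_comm a b = word_inv a @ word_inv b @ a @ b"

definition reduced :: "word \<Rightarrow> bool" where
  "reduced w \<longleftrightarrow> (\<forall>i. Suc i < length w \<longrightarrow>
      \<not> (fst (w ! i) = fst (w ! Suc i) \<and> snd (w ! i) \<noteq> snd (w ! Suc i)))"

definition word_vars :: "word \<Rightarrow> nat set" where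
  "word_vars w = fst ` set w"

definition exp_sum :: "word \<Rightarrow> nat \<Rightarrow> int" where
  "exp_sum w x = (\<Sum>l\<leftarrow>w. if fst l = x then (if snd l then -1 else 1) else 0)"

text \<open>Non-commutator word: not in the derived subgroup of the free group, i.e. the exponent
  sum in some variable is nonzero.\<close>
definition non_commutator :: "word \<Rightarrow> bool" where
  "non_commutator w \<longleftrightarrow> (\<exists>x. exp_sum w x \<noteq> 0)"

definition word_subst :: "(nat \<Rightarrow> word) \<Rightarrow> word \<Rightarrow> word" where
  "word_subst u w = concat (map (\<lambda>(x, e). if e then word_inv (u x) else u x) w)"

datatype oc = OVar nat | OComm oc oc

fun oc_vars :: "oc \<Rightarrow> nat set" where
  "oc_vars (OVar i) = {i}"
| "oc_vars (OComm a b) = oc_vars a \<union> oc_vars b"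

fun oc_wf :: "oc \<Rightarrow> bool" where
  "oc_wf (OVar i) = True"
| "oc_wf (OComm a b) = (oc_wf a \<and> oc_wf b \<and> oc_vars a \<inter> oc_vars b = {})"

fun oc_word :: "oc \<Rightarrow> word" where
  "oc_word (OVar i) = [(i, False)]"
| "oc_word (OComm a b) = word_comm (oc_word a) (oc_word b)"

definition word_eval :: "('g, 'm) monoid_scheme \<Rightarrow> (nat \<Rightarrow> 'g) \<Rightarrow> word \<Rightarrow> 'g" where
  "word_eval G f w = foldr (\<lambda>(x, e) acc. (if e then inv\<^bsub>G\<^esub> (f x) else f x) \<otimes>\<^bsub>G\<^esub> acc) w \<one>\<^bsub>G\<^esub>"

definition word_values :: "('g, 'm) monoid_scheme \<Rightarrow> word \<Rightarrow> 'g set" where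
  "word_values G w = {word_eval G f w | f. f \<in> UNIV \<rightarrow> carrier G}"

text \<open>Conciseness witnessed in a group G: if v{G} is finite then v(G) is finite.
  A word is concise iff this holds for every group G (of every type).\<close>
definition concise_in :: "('g, 'm) monoid_scheme \<Rightarrow> word \<Rightarrow> bool" where
  "concise_in G w \<longleftrightarrow>
     (finite (word_values G w) \<longrightarrow> finite (generate G (word_values G w)))"

end

theory Submission
  imports Defs
begin

text \<open>
  Let \<open>S\<^sub>m\<close> be the set of values of \<open>u\<^sub>m\<close>, \<open>N\<^sub>m\<close> the normal subgroup it generates, \<open>V\<close> the finite set
  of values \<open>w(s\<^sub>1,\<dots>,s\<^sub>r)\<close> with \<open>s\<^sub>m \<in> S\<^sub>m\<close>, and \<open>W\<close> the subgroup generated by \<open>V\<close>, which is the iterated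
  commutator subgroup \<open>w(N\<^sub>1,\<dots>,N\<^sub>r)\<close>. As \<open>V\<close> is finite and normal, \<open>W\<close> is central-by-finite, so by the
  theorems of Schur and Dietzmann its torsion elements form a normal subgroup \<open>T\<close> with \<open>W/T\<close> abelian
  and torsion-free, and \<open>W\<close> is finite once \<open>V \<subseteq> T\<close>.

  Since \<open>u\<^sub>m\<close> is a non-commutator word, \<open>S\<^sub>m\<close> contains all \<open>e\<close>-th powers for some \<open>e > 0\<close>. Hence if,
  modulo \<open>T\<close>, the word \<open>w\<close> is compatible with powers in the entries of a nonempty set \<open>I\<close> of variables
  that range over a normal subgroup \<open>A\<close>, the other entries being in \<open>S\<^sub>m\<close>, then all
  those values lie in \<open>T\<close>: otherwise some value would have infinitely many powers that are again values.
  By the three subgroup lemma the obstruction to this compatibility is covered by the subgroups obtained from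
  \<open>w\<close> by replacing the label \<open>M\<close> of one more variable by \<open>[A,M]\<close>.

  Put \<open>D\<^sub>K = \<Inter>\<^sub>m\<^sub>\<in>\<^sub>K N\<^sub>m\<close> for a nonempty set \<open>K\<close> of variables. By downward induction on \<open>K\<close>, replacing
  \<open>N\<^sub>i\<close> by \<open>D\<^sub>K\<close> for one \<open>i \<in> K\<close> gives a subgroup of \<open>T\<close>: this holds for high terms of the derived series
  of \<open>D\<^sub>K\<close>, and one climbs up that series by enlarging \<open>I\<close> inside \<open>K\<close>. The case \<open>K = {i}\<close> is \<open>W \<subseteq> T\<close>.
\<close>

subsection \<open>Commutator calculus with normal subgroups\<close>

context group
begin

definition gcomm :: "'a \<Rightarrow> 'a \<Rightarrow> 'a" where
  "gcomm a b = inv a \<otimes> inv b \<otimes> a \<otimes> b"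

definition conj_closed :: "'a set \<Rightarrow> bool" where
  "conj_closed U \<longleftrightarrow> U \<subseteq> carrier G \<and> (\<forall>x\<in>U. \<forall>g\<in>carrier G. inv g \<otimes> x \<otimes> g \<in> U)"

definition comm_sub :: "'a set \<Rightarrow> 'a set \<Rightarrow> 'a set" where
  "comm_sub A B = generate G {gcomm a b | a b. a \<in> A \<and> b \<in> B}"

text \<open>For normal \<open>Z\<close> and \<open>B\<close> inside the group, this is the preimage
  of the centralizer of \<open>B\<close> in the quotient by \<open>Z\<close>. It moves one factor of
  an inclusion \<open>comm_sub A B \<subseteq> Z\<close> to the right-hand side, so that inductions
  over commutator trees can treat one branch at a time, with a new normal subgroup as
  target.\<close>

definition centralizer_mod :: "'a set \<Rightarrow> 'a set \<Rightarrow> 'a set" where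
  "centralizer_mod Z B = {x \<in> carrier G. \<forall>b\<in>B. gcomm x b \<in> Z}"

lemma inv_cancel_left [simp]:
  assumes "x \<in> carrier G" "y \<in> carrier G"
  shows "x \<otimes> (inv x \<otimes> y) = y" "inv x \<otimes> (x \<otimes> y) = y"
  using assms by (simp_all add: m_assoc[symmetric])

lemma gcomm_closed [simp, intro]:
  "a \<in> carrier G \<Longrightarrow> b \<in> carrier G \<Longrightarrow> gcomm a b \<in> carrier G"
  by (simp add: gcomm_def)

lemma inv_gcomm:
  assumes "a \<in> carrier G" "b \<in> carrier G"
  shows "inv (gcomm a b) = gcomm b a"
  using assms by (simp add: gcomm_def inv_mult_group m_assoc)

lemma gcomm_mult_left:
  assumes "a \<in> carrier G" "b \<in> carrier G" "c \<in> carrier G"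
  shows "gcomm (a \<otimes> b) c = inv b \<otimes> gcomm a c \<otimes> b \<otimes> gcomm b c"
  using assms by (simp add: gcomm_def inv_mult_group m_assoc)

lemma gcomm_mult_right:
  assumes "a \<in> carrier G" "b \<in> carrier G" "c \<in> carrier G"
  shows "gcomm a (b \<otimes> c) = gcomm a c \<otimes> (inv c \<otimes> gcomm a b \<otimes> c)"
  using assms by (simp add: gcomm_def inv_mult_group m_assoc)

lemma gcomm_inv_left:
  assumes "a \<in> carrier G" "c \<in> carrier G"
  shows "gcomm (inv a) c = a \<otimes> inv (gcomm a c) \<otimes> inv a"
  using assms by (simp add: gcomm_def inv_mult_group m_assoc)

lemma conj_gcomm:
  assumes "a \<in> carrier G" "b \<in> carrier G" "g \<in> carrier G"
  shows "inv g \<otimes> gcomm a b \<otimes> g = gcomm (inv g \<otimes> a \<otimes> g) (inv g \<otimes> b \<otimes> g)"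
  using assms by (simp add: gcomm_def inv_mult_group m_assoc)

text \<open>An identity of free groups: after expanding the commutators and pushing inverses inside,
  adjacent letters cancel until nothing is left.\<close>

lemma hall_witt:
  assumes "x \<in> carrier G" "y \<in> carrier G" "z \<in> carrier G"
  shows "(inv y \<otimes> gcomm (gcomm x (inv y)) z \<otimes> y) \<otimes>
    (inv z \<otimes> gcomm (gcomm y (inv z)) x \<otimes> z) \<otimes>
    (inv x \<otimes> gcomm (gcomm z (inv x)) y \<otimes> x) = \<one>"
  using assms by (simp add: gcomm_def inv_mult_group m_assoc)

lemma normal_conj:
  assumes "N \<lhd> G" "x \<in> N" "g \<in> carrier G"
  shows "inv g \<otimes> x \<otimes> g \<in> N" "g \<otimes> x \<otimes> inv g \<in> N"
  using normal.inv_op_closed1 normal.inv_op_closed2 assms by metis+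

lemma normal_conj_iff:
  assumes "N \<lhd> G" "x \<in> carrier G" "g \<in> carrier G"
  shows "inv g \<otimes> x \<otimes> g \<in> N \<longleftrightarrow> x \<in> N"
proof
  assume "inv g \<otimes> x \<otimes> g \<in> N"
  from normal_conj(2)[OF assms(1) this assms(3)] show "x \<in> N"
    using assms by (simp add: m_assoc)
qed (use normal_conj assms in blast)

lemma normal_conj_closed: "N \<lhd> G \<Longrightarrow> conj_closed N"
  unfolding conj_closed_def using normal_conj(1) normal_imp_subgroup subgroup.subset by blast

lemma conj_closedD:
  assumes "conj_closed U" "x \<in> U"
  shows "x \<in> carrier G" "g \<in> carrier G \<Longrightarrow> inv g \<otimes> x \<otimes> g \<in> U"
    "g \<in> carrier G \<Longrightarrow> g \<otimes> x \<otimes> inv g \<in> U"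
proof -
  show "x \<in> carrier G" "g \<in> carrier G \<Longrightarrow> inv g \<otimes> x \<otimes> g \<in> U"
    using assms by (auto simp: conj_closed_def)
  show "g \<otimes> x \<otimes> inv g \<in> U" if "g \<in> carrier G"
    using assms that inv_closed[OF that] inv_inv[OF that] unfolding conj_closed_def by metis
qed

lemma normalI_conj:
  assumes "subgroup N G" "\<And>x g. x \<in> N \<Longrightarrow> g \<in> carrier G \<Longrightarrow> inv g \<otimes> x \<otimes> g \<in> N"
  shows "N \<lhd> G"
  unfolding normal_inv_iff using assms by (metis inv_closed inv_inv)

lemma generate_conj_closed_normal:
  assumes "conj_closed U"
  shows "generate G U \<lhd> G"
proof (rule normalI_conj)
  have U: "U \<subseteq> carrier G" using assms by (simp add: conj_closed_def)
  show "subgroup (generate G U) G" by (rule generate_is_subgroup[OF U])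
  show "inv g \<otimes> x \<otimes> g \<in> generate G U" if "x \<in> generate G U" "g \<in> carrier G" for x g
    using that
  proof (induction x rule: generate.induct)
    case one then show ?case by (simp add: generate.one)
  next
    case (incl h) then show ?case
      using conj_closedD[OF assms] by (blast intro: generate.incl)
  next
    case (inv h)
    have "inv g \<otimes> inv h \<otimes> g = inv (inv g \<otimes> h \<otimes> g)"
      using conj_closedD(1)[OF assms inv.hyps] inv.prems by (simp add: inv_mult_group m_assoc)
    then show ?case
      using conj_closedD(2)[OF assms inv.hyps inv.prems] by (simp add: generate.inv)
  next
    case (eng h1 h2)
    have c: "h1 \<in> carrier G" "h2 \<in> carrier G"
      using eng.hyps generate_in_carrier[OF U] by blast+
    have "inv g \<otimes> (h1 \<otimes> h2) \<otimes> g = (inv g \<otimes> h1 \<otimes> g) \<otimes> (inv g \<otimes> h2 \<otimes> g)"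
      using c eng.prems by (simp add: m_assoc)
    then show ?case using eng by (simp add: generate.eng)
  qed
qed

text \<open>Products are handled by [xy,b] = [x,b]^y [y,b] and conjugates by [x^g,b] = [x,gbg^-1]^g.
  Normality is what allows the result to serve again as a target in the inductions below.\<close>

lemma centralizer_mod_normal:
  assumes "Z \<lhd> G" "conj_closed B"
  shows "centralizer_mod Z B \<lhd> G"
proof (rule normalI_conj)
  have Z: "subgroup Z G" using assms(1) by (rule normal_imp_subgroup)
  note B = conj_closedD[OF assms(2)]
  show "subgroup (centralizer_mod Z B) G"
  proof
    show "centralizer_mod Z B \<subseteq> carrier G" by (auto simp: centralizer_mod_def)
    show "\<one> \<in> centralizer_mod Z B"
      using B subgroup.one_closed[OF Z] by (auto simp: centralizer_mod_def gcomm_def)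
    show "x \<otimes> y \<in> centralizer_mod Z B" 
      if "x \<in> centralizer_mod Z B" "y \<in> centralizer_mod Z B" for x y
      using that B normal_conj[OF assms(1)] subgroup.m_closed[OF Z]
      by (auto simp: centralizer_mod_def gcomm_mult_left)
    show "inv x \<in> centralizer_mod Z B" if "x \<in> centralizer_mod Z B" for x
      using that B normal_conj[OF assms(1)] subgroup.m_inv_closed[OF Z]
      by (auto simp: centralizer_mod_def gcomm_inv_left)
  qed
  show "inv g \<otimes> x \<otimes> g \<in> centralizer_mod Z B"
    if x: "x \<in> centralizer_mod Z B" and g: "g \<in> carrier G" for x g
  proof -
    have xc: "x \<in> carrier G" using x by (simp add: centralizer_mod_def)
    have "gcomm (inv g \<otimes> x \<otimes> g) b \<in> Z" if b: "b \<in> B" for b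
    proof -
      have "g \<otimes> b \<otimes> inv g \<in> B" using B(3)[OF b g] .
      then have "gcomm x (g \<otimes> b \<otimes> inv g) \<in> Z" using x by (simp add: centralizer_mod_def)
      from normal_conj(1)[OF assms(1) this g]
      have "inv g \<otimes> gcomm x (g \<otimes> b \<otimes> inv g) \<otimes> g \<in> Z" .
      also have "inv g \<otimes> gcomm x (g \<otimes> b \<otimes> inv g) \<otimes> g = gcomm (inv g \<otimes> x \<otimes> g) b"
        using xc g B(1)[OF b] by (simp add: gcomm_def inv_mult_group m_assoc)
      finally show ?thesis .
    qed
    then show ?thesis using xc g by (simp add: centralizer_mod_def)
  qed
qed

lemma comm_sub_subset_iff:
  assumes "subgroup Z G" "A \<subseteq> carrier G"
  shows "comm_sub A B \<subseteq> Z \<longleftrightarrow> A \<subseteq> centralizer_mod Z B"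
proof
  assume "comm_sub A B \<subseteq> Z"
  then show "A \<subseteq> centralizer_mod Z B"
    using assms(2) generate.incl[of _ "{gcomm a b | a b. a \<in> A \<and> b \<in> B}" G]
    unfolding comm_sub_def centralizer_mod_def by blast
next
  assume "A \<subseteq> centralizer_mod Z B"
  then have "{gcomm a b | a b. a \<in> A \<and> b \<in> B} \<subseteq> Z"
    unfolding centralizer_mod_def by blast
  then show "comm_sub A B \<subseteq> Z"
    unfolding comm_sub_def using generate_subgroup_incl assms(1) by blast
qed

lemma comm_sub_incl: "a \<in> A \<Longrightarrow> b \<in> B \<Longrightarrow> gcomm a b \<in> comm_sub A B"
  unfolding comm_sub_def by (blast intro: generate.incl)

lemma comm_sub_mono: "A \<subseteq> A' \<Longrightarrow> B \<subseteq> B' \<Longrightarrow> comm_sub A B \<subseteq> comm_sub A' B'"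
  unfolding comm_sub_def by (rule mono_generate) blast

lemma comm_sub_commute:
  assumes "A \<subseteq> carrier G" "B \<subseteq> carrier G"
  shows "comm_sub A B = comm_sub B A"
proof -
  have *: "comm_sub A B \<subseteq> comm_sub B A" if AB: "A \<subseteq> carrier G" "B \<subseteq> carrier G" for A B
  proof -
    have s: "subgroup (comm_sub B A) G"
      unfolding comm_sub_def using AB by (intro generate_is_subgroup) blast
    have "gcomm a b \<in> comm_sub B A" if ab: "a \<in> A" "b \<in> B" for a b
    proof -
      have "inv (gcomm b a) \<in> comm_sub B A"
        by (rule subgroup.m_inv_closed[OF s comm_sub_incl[OF ab(2,1)]])
      moreover have "inv (gcomm b a) = gcomm a b" using ab AB by (intro inv_gcomm) auto
      ultimately show ?thesis by simp
    qed
    then show ?thesis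
      using comm_sub_subset_iff[OF s AB(1)] AB(1) by (auto simp: centralizer_mod_def)
  qed
  show ?thesis using *[OF assms] *[OF assms(2,1)] by blast
qed

lemma conj_closed_gcomms:
  assumes "conj_closed A" "conj_closed B"
  shows "conj_closed {gcomm a b | a b. a \<in> A \<and> b \<in> B}"
proof -
  have "inv g \<otimes> gcomm a b \<otimes> g \<in> {gcomm a b | a b. a \<in> A \<and> b \<in> B}"
    if "a \<in> A" "b \<in> B" "g \<in> carrier G" for a b g
  proof -
    have "inv g \<otimes> gcomm a b \<otimes> g = gcomm (inv g \<otimes> a \<otimes> g) (inv g \<otimes> b \<otimes> g)"
      using conj_closedD(1)[OF assms(1)] conj_closedD(1)[OF assms(2)] that
      by (intro conj_gcomm) auto
    moreover have "inv g \<otimes> a \<otimes> g \<in> A" "inv g \<otimes> b \<otimes> g \<in> B"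
      using conj_closedD(2)[OF assms(1)] conj_closedD(2)[OF assms(2)] that by auto
    ultimately show ?thesis by blast
  qed
  moreover have "{gcomm a b | a b. a \<in> A \<and> b \<in> B} \<subseteq> carrier G"
    using conj_closedD(1)[OF assms(1)] conj_closedD(1)[OF assms(2)] by auto
  ultimately show ?thesis unfolding conj_closed_def by blast
qed

lemma comm_sub_normal:
  assumes "A \<lhd> G" "B \<lhd> G"
  shows "comm_sub A B \<lhd> G"
  unfolding comm_sub_def
  by (intro generate_conj_closed_normal conj_closed_gcomms normal_conj_closed assms)

lemma normal_subset: "N \<lhd> G \<Longrightarrow> N \<subseteq> carrier G"
  by (simp add: normal_imp_subgroup subgroup.subset)

lemma comm_sub_subset_left:
  assumes "A \<lhd> G" "B \<subseteq> carrier G"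
  shows "comm_sub A B \<subseteq> A"
proof -
  have s: "subgroup A G" by (rule normal_imp_subgroup[OF assms(1)])
  have "gcomm a b \<in> A" if "a \<in> A" "b \<in> B" for a b
  proof -
    have c: "a \<in> carrier G" "b \<in> carrier G" using that normal_subset[OF assms(1)] assms(2) by auto
    have "inv a \<otimes> (inv b \<otimes> a \<otimes> b) \<in> A"
      using normal_conj(1)[OF assms(1) that(1) c(2)] that(1) s
      by (simp add: subgroup.m_closed subgroup.m_inv_closed)
    then show ?thesis using c by (simp add: gcomm_def m_assoc)
  qed
  then show ?thesis
    using comm_sub_subset_iff[OF s normal_subset[OF assms(1)]] normal_subset[OF assms(1)]
    by (auto simp: centralizer_mod_def)
qed

lemma comm_sub_subset_right:
  assumes "A \<subseteq> carrier G" "B \<lhd> G"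
  shows "comm_sub A B \<subseteq> B"
  using comm_sub_subset_left[OF assms(2,1)] comm_sub_commute[OF assms(1) normal_subset[OF assms(2)]]
  by simp

lemma comm_sub_subset_iff_right:
  assumes "subgroup Z G" "A \<subseteq> carrier G" "B \<subseteq> carrier G"
  shows "comm_sub A B \<subseteq> Z \<longleftrightarrow> B \<subseteq> centralizer_mod Z A"
  using comm_sub_subset_iff[OF assms(1,3), of A] comm_sub_commute[OF assms(2,3)] by simp

text \<open>The three subgroup lemma modulo \<open>Y\<close>: two of the three Hall-Witt factors lie
  in \<open>Y\<close>, hence so does the third.\<close>

lemma three_subgroups:
  assumes U: "U \<lhd> G" and C: "C \<lhd> G" and D: "D \<lhd> G" and Y: "Y \<lhd> G"
    and 1: "comm_sub (comm_sub U C) D \<subseteq> Y" and 2: "comm_sub (comm_sub U D) C \<subseteq> Y"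
  shows "comm_sub U (comm_sub C D) \<subseteq> Y"
proof -
  have sY: "subgroup Y G" and sU: "subgroup U G" and sC: "subgroup C G" and sD: "subgroup D G"
    using U C D Y normal_imp_subgroup by blast+
  have "gcomm (gcomm c d) x \<in> Y" if c: "c \<in> C" and d: "d \<in> D" and x: "x \<in> U" for c d x
  proof -
    have cc: "c \<in> carrier G" "d \<in> carrier G" "x \<in> carrier G"
      using c d x normal_subset U C D by blast+
    \<comment> \<open>Hall-Witt inverts one entry of each inner commutator; starting from
      \<open>inv d\<close> makes the first inner commutator equal to [c,d].\<close>
    let ?d = "inv d"
    have d': "?d \<in> D" using d sD by (simp add: subgroup.m_inv_closed)
    have a1: "gcomm (gcomm ?d (inv x)) c \<in> Y"
    proof -
      have "gcomm ?d (inv x) \<in> comm_sub D U"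
        using d' x sU by (intro comm_sub_incl) (auto simp: subgroup.m_inv_closed)
      then have "gcomm ?d (inv x) \<in> comm_sub U D"
        using comm_sub_commute[OF normal_subset[OF U] normal_subset[OF D]] by simp
      then show ?thesis using comm_sub_incl[OF _ c] 2 by blast
    qed
    have a2: "gcomm (gcomm x (inv c)) ?d \<in> Y"
    proof -
      have "gcomm x (inv c) \<in> comm_sub U C"
        using c x sC by (intro comm_sub_incl) (auto simp: subgroup.m_inv_closed)
      then show ?thesis using comm_sub_incl[OF _ d'] 1 by blast
    qed
    let ?P = "inv ?d \<otimes> gcomm (gcomm c (inv ?d)) x \<otimes> ?d"
    let ?Q = "inv x \<otimes> gcomm (gcomm ?d (inv x)) c \<otimes> x"
    let ?R = "inv c \<otimes> gcomm (gcomm x (inv c)) ?d \<otimes> c"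
    have "?P \<otimes> ?Q \<otimes> ?R = \<one>" using hall_witt[of c ?d x] cc by simp
    then have "?P = inv (?Q \<otimes> ?R)"
      using cc by (intro inv_equality[symmetric]) (simp_all add: m_assoc del: inv_inv)
    moreover have "?Q \<otimes> ?R \<in> Y"
      using normal_conj(1)[OF Y] a1 a2 cc subgroup.m_closed[OF sY] by blast
    ultimately have "?P \<in> Y" using subgroup.m_inv_closed[OF sY] by simp
    then show ?thesis using normal_conj_iff[OF Y, of "gcomm (gcomm c d) x" ?d] cc by simp
  qed
  \<comment> \<open>Commutators [c,d] centralize \<open>U\<close> modulo \<open>Y\<close>; as such
    elements form a subgroup, the whole of \<open>comm_sub C D\<close> does.\<close>
  then have "C \<subseteq> carrier G \<Longrightarrow> {gcomm a b | a b. a \<in> C \<and> b \<in> D} \<subseteq> centralizer_mod Y U"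
    using normal_subset[OF D] by (auto simp: centralizer_mod_def)
  then have "comm_sub C D \<subseteq> centralizer_mod Y U"
    unfolding comm_sub_def using normal_subset[OF C] normal_imp_subgroup
      centralizer_mod_normal[OF Y normal_conj_closed[OF U]] generate_subgroup_incl by blast
  then show ?thesis
    using comm_sub_subset_iff_right[OF sY normal_subset[OF U]] comm_sub_normal[OF C D]
      normal_subset by blast
qed

end

subsection \<open>The theorems of Dietzmann and Schur\<close>

text \<open>On \<open>A\<close> the map \<open>g\<close> factors through \<open>f\<close>; choosing
  a preimage for each value of \<open>f\<close> makes the factorization explicit.\<close>

lemma finite_image_factor:
  assumes "finite (f ` A)" "\<And>a b. a \<in> A \<Longrightarrow> b \<in> A \<Longrightarrow> f a = f b \<Longrightarrow> g a = g b"
  shows "finite (g ` A)"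
proof (rule finite_subset)
  show "g ` A \<subseteq> (\<lambda>c. g (inv_into A f c)) ` f ` A"
  proof
    fix b assume "b \<in> g ` A"
    then obtain a where a: "a \<in> A" "b = g a" by blast
    have "g (inv_into A f (f a)) = g a"
      using a by (intro assms(2)) (auto simp: inv_into_into f_inv_into_f)
    then show "b \<in> (\<lambda>c. g (inv_into A f c)) ` f ` A" using a by force
  qed
qed (use assms in simp)

lemma not_inj_nat_finite:
  fixes f :: "nat \<Rightarrow> 'a"
  assumes "finite B" "\<And>n. f n \<in> B"
  obtains a b where "a < b" "f a = f b"
proof -
  have "finite (range f)" by (rule finite_subset[OF _ assms(1)]) (use assms(2) in auto)
  then have "\<not> inj f" using finite_imageD[of f UNIV] by auto
  then obtain x y where "x \<noteq> y" "f x = f y" by (auto simp: inj_def)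
  then show ?thesis using that[of x y] that[of y x] by (cases "x < y") auto
qed

context group
begin

lemma subgroup_nat_pow_closed: "subgroup H G \<Longrightarrow> y \<in> H \<Longrightarrow> y [^] (n::nat) \<in> H"
  by (induction n) (auto simp: subgroup.one_closed subgroup.m_closed)

section \<open>Products of lists and the shortening of words\<close>

definition list_prod :: "'a list \<Rightarrow> 'a" where
  "list_prod xs = foldr (\<otimes>) xs \<one>"

lemma list_prod_simps [simp]: "list_prod [] = \<one>" "list_prod (x # xs) = x \<otimes> list_prod xs"
  by (simp_all add: list_prod_def)

lemma list_prod_closed [simp]: "set xs \<subseteq> carrier G \<Longrightarrow> list_prod xs \<in> carrier G"
  by (induction xs) auto

lemma list_prod_append:
  "set xs \<subseteq> carrier G \<Longrightarrow> set ys \<subseteq> carrier G \<Longrightarrow> list_prod (xs @ ys) = list_prod xs \<otimes> list_prod ys"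
  by (induction xs) (auto simp: m_assoc)

lemma list_prod_replicate: "x \<in> carrier G \<Longrightarrow> list_prod (replicate n x) = x [^] n"
proof (induction n)
  case (Suc n)
  then show ?case using nat_pow_Suc2[of x n] by simp
qed simp

lemma conj_nat_pow:
  assumes "x \<in> carrier G" "y \<in> carrier G"
  shows "(inv y \<otimes> x \<otimes> y) [^] (n::nat) = inv y \<otimes> x [^] n \<otimes> y"
proof (induction n)
  case (Suc n)
  then show ?case using assms by (simp add: m_assoc)
qed (use assms in simp)

lemma conj_mult:
  assumes "x \<in> carrier G" "g \<in> carrier G" "h \<in> carrier G"
  shows "inv h \<otimes> (inv g \<otimes> x \<otimes> g) \<otimes> h = inv (g \<otimes> h) \<otimes> x \<otimes> (g \<otimes> h)"
  using assms by (simp add: inv_mult_group m_assoc)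

lemma nat_pow_eq_imp_one:
  assumes "x \<in> carrier G" "x [^] a = x [^] b" "a < (b::nat)"
  shows "x [^] (b - a) = \<one>"
proof -
  have "x [^] (b - a) \<otimes> x [^] a = x [^] b" using assms(1,3) by (simp add: nat_pow_mult)
  also have "\<dots> = \<one> \<otimes> x [^] a" using assms(1,2) by simp
  finally show ?thesis using assms(1) by (simp only: r_cancel nat_pow_closed one_closed)
qed

lemma finite_subgroup_torsion:
  assumes "subgroup H G" "finite H" "x \<in> H"
  shows "\<exists>n::nat. 0 < n \<and> x [^] n = \<one>"
proof -
  have "\<And>n::nat. x [^] n \<in> H" using assms subgroup_nat_pow_closed by blast
  then obtain a b :: nat where ab: "a < b" "x [^] a = x [^] b"
    using not_inj_nat_finite[OF assms(2), of "\<lambda>n. x [^] n"] by blast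
  have "x [^] (b - a) = \<one>"
    by (rule nat_pow_eq_imp_one[OF subgroup.mem_carrier[OF assms(1,3)] ab(2,1)])
  then show ?thesis using ab(1) zero_less_diff by blast
qed

text \<open>Copies of \<open>x\<close> are moved to the front one letter at a time. A letter that is
  passed gets conjugated by a power of \<open>x\<close>, so it stays in \<open>U\<close> and the
  number of letters does not change.\<close>

lemma collect_powers:
  assumes U: "U \<subseteq> carrier G" "\<And>x y. x \<in> U \<Longrightarrow> y \<in> U \<Longrightarrow> inv y \<otimes> x \<otimes> y \<in> U" and x: "x \<in> U"
  shows "set xs \<subseteq> U \<Longrightarrow> k \<le> count_list xs x \<Longrightarrow>
    \<exists>ys. set ys \<subseteq> U \<and> length ys + k = length xs \<and> list_prod xs = x [^] k \<otimes> list_prod ys"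
proof (induction xs arbitrary: k)
  case Nil
  then show ?case by simp
next
  case (Cons z zs)
  have xc: "x \<in> carrier G" and zc: "z \<in> carrier G" and zU: "z \<in> U" using x U Cons.prems by auto
  show ?case
  proof (cases "k = 0 \<or> z \<noteq> x")
    case False
    then obtain j where j: "k = Suc j" "z = x" by (cases k) auto
    then obtain ys where ys: "set ys \<subseteq> U" "length ys + j = length zs"
      "list_prod zs = x [^] j \<otimes> list_prod ys"
      using Cons.IH[of j] Cons.prems by auto
    then have "list_prod ys \<in> carrier G" using U by (intro list_prod_closed) blast
    then have "list_prod (z # zs) = x [^] k \<otimes> list_prod ys"
      using ys j xc nat_pow_Suc2[OF xc, of j] by (simp add: m_assoc[symmetric] del: nat_pow_Suc)
    then show ?thesis using ys j by (intro exI[of _ ys]) simp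
  next
    case True
    then have "k \<le> count_list zs x" using Cons.prems by auto
    then obtain ys where ys: "set ys \<subseteq> U" "length ys + k = length zs"
      "list_prod zs = x [^] k \<otimes> list_prod ys"
      using Cons.IH[of k] Cons.prems by auto
    then have yc: "list_prod ys \<in> carrier G" using U by (intro list_prod_closed) blast
    have cj: "inv (x [^] j) \<otimes> z \<otimes> x [^] j \<in> U" for j :: nat
    proof (induction j)
      case (Suc j)
      then show ?case using U(2)[OF Suc x] conj_mult[OF zc, of "x [^] j" x] xc by simp
    qed (use zU zc in simp)
    have "list_prod (z # zs) = x [^] k \<otimes> list_prod ((inv (x [^] k) \<otimes> z \<otimes> x [^] k) # ys)"
      using ys xc zc yc by (simp add: m_assoc)
    then show ?thesis using ys cj[of k]
      by (intro exI[of _ "(inv (x [^] k) \<otimes> z \<otimes> x [^] k) # ys"]) simp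
  qed
qed

text \<open>The common core of the theorems of Dietzmann and Schur. In a long word some letter
  occurs often enough to be collected into a power that can be replaced by fewer letters; hence all
  elements are products of boundedly many letters.\<close>

lemma finite_generate_if_powers_shorten:
  assumes fin: "finite U" and U: "U \<subseteq> carrier G" "\<And>x y. x \<in> U \<Longrightarrow> y \<in> U \<Longrightarrow> inv y \<otimes> x \<otimes> y \<in> U"
    and short: "\<And>x. x \<in> U \<Longrightarrow> \<exists>n ys. set ys \<subseteq> U \<and> length ys < n \<and> x [^] n = list_prod ys"
    and inverses: "\<And>x. x \<in> U \<Longrightarrow> \<exists>ys. set ys \<subseteq> U \<and> inv x = list_prod ys"
  shows "finite (generate G U)"
proof -
  have "\<forall>x\<in>U. \<exists>n. \<exists>ys. set ys \<subseteq> U \<and> length ys < n \<and> x [^] n = list_prod ys" using short by blast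
  from bchoice[OF this] obtain n
    where n: "\<And>x. x \<in> U \<Longrightarrow> \<exists>ys. set ys \<subseteq> U \<and> length ys < n x \<and> x [^] n x = list_prod ys"
    by blast
  let ?L = "sum n U"
  have shorten: "\<exists>ys. set ys \<subseteq> U \<and> length ys \<le> ?L \<and> list_prod ys = list_prod xs" if "set xs \<subseteq> U" for xs
    using that
  proof (induction xs rule: length_induct)
    case (1 xs)
    show ?case
    proof (cases "length xs \<le> ?L")
      case True
      then show ?thesis using 1 by blast
    next
      case False
      \<comment> \<open>Pigeonhole: the multiplicities add up to the length of \<open>xs\<close>,
        which exceeds the sum of the thresholds \<open>n x\<close>.\<close>
      have "\<exists>x\<in>U. n x \<le> count_list xs x"
      proof (rule ccontr)
        assume "\<not> ?thesis"
        then have "sum (count_list xs) U \<le> ?L" by (intro sum_mono) auto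
        then show False using sum_count_set[OF 1(2) fin] False by simp
      qed
      then obtain x where x: "x \<in> U" "n x \<le> count_list xs x" by blast
      obtain ys where ys: "set ys \<subseteq> U" "length ys + n x = length xs"
        "list_prod xs = x [^] n x \<otimes> list_prod ys"
        using collect_powers[OF U x(1) 1(2) x(2)] by blast
      obtain zs where zs: "set zs \<subseteq> U" "length zs < n x" "x [^] n x = list_prod zs"
        using n[OF x(1)] by blast
      have "list_prod (zs @ ys) = list_prod xs"
        using list_prod_append[of zs ys] ys zs U(1) by simp
      moreover have "length (zs @ ys) < length xs" "set (zs @ ys) \<subseteq> U" using ys zs by auto
      ultimately obtain us where "set us \<subseteq> U" "length us \<le> ?L" "list_prod us = list_prod xs"
        using 1(1)[rule_format, of "zs @ ys"] by auto
      then show ?thesis by blast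
    qed
  qed
  have "\<exists>xs. set xs \<subseteq> U \<and> g = list_prod xs" if "g \<in> generate G U" for g
    using that
  proof (induction g rule: generate.induct)
    case one
    then show ?case by (intro exI[of _ "[]"]) simp
  next
    case (incl h)
    then show ?case using U by (intro exI[of _ "[h]"]) auto
  next
    case (inv h)
    then show ?case using inverses by blast
  next
    case (eng h1 h2)
    then obtain xs ys where xy: "set xs \<subseteq> U" "h1 = list_prod xs" "set ys \<subseteq> U" "h2 = list_prod ys"
      by blast
    have "h1 \<otimes> h2 = list_prod (xs @ ys)" using xy U(1) list_prod_append[of xs ys] by auto
    moreover have "set (xs @ ys) \<subseteq> U" using xy by simp
    ultimately show ?case by blast
  qed
  then have "generate G U \<subseteq> list_prod ` {ys. set ys \<subseteq> U \<and> length ys \<le> ?L}"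
    using shorten by (smt (verit) image_eqI mem_Collect_eq subsetI)
  then show ?thesis using finite_lists_length_le[OF fin] finite_subset by blast
qed

text \<open>A letter of finite order has a power equal to the empty product, which is shorter, and
  its inverse is a nonnegative power.\<close>

theorem dietzmann:
  assumes "finite U" "U \<subseteq> carrier G" "\<And>x y. x \<in> U \<Longrightarrow> y \<in> U \<Longrightarrow> inv y \<otimes> x \<otimes> y \<in> U"
    and tor: "\<And>x. x \<in> U \<Longrightarrow> \<exists>n::nat. 0 < n \<and> x [^] n = \<one>"
  shows "finite (generate G U)"
proof (rule finite_generate_if_powers_shorten[OF assms(1-3)])
  fix x assume x: "x \<in> U"
  then obtain n :: nat where n: "0 < n" "x [^] n = \<one>" using tor by blast
  have xc: "x \<in> carrier G" using x assms by blast
  show "\<exists>n ys. set ys \<subseteq> U \<and> length ys < n \<and> x [^] n = list_prod ys"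
    by (rule exI[of _ n], rule exI[of _ "[]"]) (use n in simp)
  have "x [^] (n - 1) \<otimes> x = \<one>" using n nat_pow_Suc[of x "n - 1"] by simp
  then have "inv x = list_prod (replicate (n - 1) x)"
    unfolding list_prod_replicate[OF xc] by (rule inv_equality) (use xc in auto)
  moreover have "set (replicate (n - 1) x) \<subseteq> U" using x by auto
  ultimately show "\<exists>ys. set ys \<subseteq> U \<and> inv x = list_prod ys" by blast
qed

lemma gcomm_eq_conj:
  assumes "x \<in> carrier G" "y \<in> carrier G"
  shows "gcomm x y = inv x \<otimes> (inv y \<otimes> x \<otimes> y)" "gcomm x y = (inv x \<otimes> inv y \<otimes> x) \<otimes> y"
  using assms by (simp_all add: gcomm_def m_assoc)

lemma conj_eq_on_generate:
  assumes V: "V \<subseteq> carrier G" and g: "g \<in> carrier G" "h \<in> carrier G"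
    and eq: "\<And>v. v \<in> V \<Longrightarrow> inv g \<otimes> v \<otimes> g = inv h \<otimes> v \<otimes> h"
    and w: "w \<in> generate G V"
  shows "inv g \<otimes> w \<otimes> g = inv h \<otimes> w \<otimes> h"
  using w
proof (induction w rule: generate.induct)
  case one
  then show ?case using g by simp
next
  case (incl v)
  then show ?case by (rule eq)
next
  case (inv v)
  have vc: "v \<in> carrier G" using inv V by blast
  have "inv k \<otimes> inv v \<otimes> k = inv (inv k \<otimes> v \<otimes> k)" if "k \<in> carrier G" for k
    using vc that by (simp add: inv_mult_group m_assoc)
  then show ?case using eq[OF inv] g by simp
next
  case (eng a b)
  have c: "a \<in> carrier G" "b \<in> carrier G" using eng generate_in_carrier[OF V] by blast+
  have "inv k \<otimes> (a \<otimes> b) \<otimes> k = (inv k \<otimes> a \<otimes> k) \<otimes> (inv k \<otimes> b \<otimes> k)" if "k \<in> carrier G" for k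
    using c that by (simp add: m_assoc)
  then show ?case using eng.IH g by simp
qed

text \<open>Restricting to \<open>V\<close> makes two group elements with the same conjugation
  action on \<open>V\<close> give equal functions, and there are only finitely many maps from
  \<open>V\<close> to itself.\<close>

lemma finite_conj_action:
  assumes V: "finite V" "conj_closed V"
  shows "finite ((\<lambda>g. restrict (\<lambda>v. inv g \<otimes> v \<otimes> g) V) ` carrier G)"
proof (rule finite_subset)
  show "(\<lambda>g. restrict (\<lambda>v. inv g \<otimes> v \<otimes> g) V) ` carrier G \<subseteq> (V \<rightarrow>\<^sub>E V)"
    using conj_closedD(2)[OF V(2)] by auto
  show "finite (V \<rightarrow>\<^sub>E V)" using V by (intro finite_PiE) auto
qed

lemma conj_action_eqD:
  assumes "restrict (\<lambda>v. inv g \<otimes> v \<otimes> g) V = restrict (\<lambda>v. inv h \<otimes> v \<otimes> h) V" "v \<in> V"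
  shows "inv g \<otimes> v \<otimes> g = inv h \<otimes> v \<otimes> h"
  using fun_cong[OF assms(1), of v] assms(2) by simp

section \<open>The subgroup generated by a finite conjugation-closed set\<close>

context
  fixes V W
  assumes V: "finite V" "conj_closed V" and W_def: "W = generate G V"
begin

lemma V_carrier: "V \<subseteq> carrier G"
  using V(2) by (simp add: conj_closed_def)

lemma W_normal: "W \<lhd> G"
  unfolding W_def by (rule generate_conj_closed_normal[OF V(2)])

lemma W_subgroup: "subgroup W G"
  by (rule normal_imp_subgroup[OF W_normal])

lemma W_carrier: "w \<in> W \<Longrightarrow> w \<in> carrier G"
  using normal_subset[OF W_normal] by blast

text \<open>For \<open>x\<close>, \<open>y\<close> in \<open>W\<close>, the commutator [x,y] depends
  only on how \<open>x\<close> and \<open>y\<close> act on \<open>V\<close>, because an action on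
  \<open>V\<close> determines the action on \<open>W\<close>.\<close>

lemma finite_gcomms: "finite {gcomm x y | x y. x \<in> W \<and> y \<in> W}"
proof -
  let ?f = "\<lambda>g. restrict (\<lambda>v. inv g \<otimes> v \<otimes> g) V"
  have "finite ((\<lambda>(x, y). gcomm x y) ` (W \<times> W))"
  proof (rule finite_image_factor)
    have "(\<lambda>(x, y). (?f x, ?f y)) ` (W \<times> W) \<subseteq> (?f ` carrier G) \<times> (?f ` carrier G)"
      using W_carrier by auto
    then show "finite ((\<lambda>(x, y). (?f x, ?f y)) ` (W \<times> W))"
      using finite_conj_action[OF V] finite_subset finite_cartesian_product by blast
    fix a b
    assume a: "a \<in> W \<times> W" and b: "b \<in> W \<times> W"
      and eq: "(\<lambda>(x, y). (?f x, ?f y)) a = (\<lambda>(x, y). (?f x, ?f y)) b"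
    obtain x y x' y' where ab: "a = (x, y)" "b = (x', y')" by (cases a, cases b) blast
    have W: "x \<in> W" "y \<in> W" "x' \<in> W" "y' \<in> W" using a b ab by auto
    have c: "x \<in> carrier G" "y \<in> carrier G" "x' \<in> carrier G" "y' \<in> carrier G"
      using W W_carrier by auto
    have fx: "?f x = ?f x'" and fy: "?f y = ?f y'" using eq ab by auto
    \<comment> \<open>Writing [x,y] as x^-1 x^y allows \<open>y\<close> to be replaced by
      \<open>y'\<close>; writing [x,y'] as (y'^-1)^x y' then allows \<open>x\<close> to be replaced
      by \<open>x'\<close>.\<close>
    have 1: "inv y \<otimes> x \<otimes> y = inv y' \<otimes> x \<otimes> y'"
      by (rule conj_eq_on_generate[OF V_carrier c(2,4) conj_action_eqD[OF fy]]) (use W W_def in auto)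
    have "inv x \<otimes> inv y' \<otimes> x = inv x' \<otimes> inv y' \<otimes> x'"
      by (rule conj_eq_on_generate[OF V_carrier c(1,3) conj_action_eqD[OF fx]])
        (use W subgroup.m_inv_closed[OF W_subgroup] W_def in auto)
    then have "gcomm x y = gcomm x' y'"
      using gcomm_eq_conj(1)[OF c(1,2)] gcomm_eq_conj(1)[OF c(1,4)] 1
        gcomm_eq_conj(2)[OF c(1,4)] gcomm_eq_conj(2)[OF c(3,4)] by simp
    then show "(\<lambda>(x, y). gcomm x y) a = (\<lambda>(x, y). gcomm x y) b" using ab by simp
  qed
  moreover have "(\<lambda>(x, y). gcomm x y) ` (W \<times> W) = {gcomm x y | x y. x \<in> W \<and> y \<in> W}" by auto
  ultimately show ?thesis by simp
qed

text \<open>Two different powers of \<open>x\<close> act alike on \<open>V\<close>, hence on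
  \<open>W\<close>; their quotient then centralizes \<open>W\<close>.\<close>

lemma power_central:
  assumes x: "x \<in> W"
  shows "\<exists>k::nat. 0 < k \<and> (\<forall>w\<in>W. inv w \<otimes> x [^] k \<otimes> w = x [^] k)"
proof -
  let ?f = "\<lambda>g. restrict (\<lambda>v. inv g \<otimes> v \<otimes> g) V"
  have xc: "x \<in> carrier G" using x W_carrier by blast
  obtain a b :: nat where ab: "a < b" "?f (x [^] a) = ?f (x [^] b)"
    using not_inj_nat_finite[OF finite_conj_action[OF V], of "\<lambda>n. ?f (x [^] n)"] xc by blast
  let ?k = "b - a"
  have xb: "x [^] b = x [^] ?k \<otimes> x [^] a" using xc ab by (simp add: nat_pow_mult)
  have "inv w \<otimes> x [^] ?k \<otimes> w = x [^] ?k" if w: "w \<in> W" for w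
  proof -
    have wc: "w \<in> carrier G" using w W_carrier by blast
    have kc: "x [^] ?k \<in> carrier G" "x [^] a \<in> carrier G" using xc by auto
    have "inv (x [^] a) \<otimes> w \<otimes> x [^] a = inv (x [^] b) \<otimes> w \<otimes> x [^] b"
      by (rule conj_eq_on_generate[OF V_carrier _ _ conj_action_eqD[OF ab(2)]]) (use xc w W_def in auto)
    also have "\<dots> = inv (x [^] a) \<otimes> (inv (x [^] ?k) \<otimes> w \<otimes> x [^] ?k) \<otimes> x [^] a"
      unfolding xb using conj_mult[OF wc kc] by simp
    finally have "inv (x [^] a) \<otimes> w = inv (x [^] a) \<otimes> (inv (x [^] ?k) \<otimes> w \<otimes> x [^] ?k)"
      by (rule r_cancel) (use wc kc in auto)
    then have "w = inv (x [^] ?k) \<otimes> w \<otimes> x [^] ?k"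
      by (rule l_cancel) (use wc kc in auto)
    then have "x [^] ?k \<otimes> w = w \<otimes> x [^] ?k"
      using wc kc by (metis inv_cancel_left(1) inv_closed m_assoc m_closed)
    then show ?thesis using wc kc by (simp add: m_assoc)
  qed
  then show ?thesis using ab by (intro exI[of _ ?k]) simp
qed

text \<open>Schur's theorem; a high power of a commutator is a product of fewer commutators because
  \<open>c\<^sup>k\<^sup>+\<^sup>1 = c (c\<^sup>k)\<^sup>y = [x,y\<^sup>2] [x\<^sup>y,y]\<^sup>k\<^sup>-\<^sup>1\<close> whenever \<open>c = [x,y]\<close> and \<open>c\<^sup>k\<close> is central.\<close>

lemma finite_commutator_subgroup: "finite (comm_sub W W)"
  unfolding comm_sub_def
proof (rule finite_generate_if_powers_shorten)
  let ?U = "{gcomm x y | x y. x \<in> W \<and> y \<in> W}"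
  have cc: "conj_closed ?U"
    by (intro conj_closed_gcomms normal_conj_closed W_normal)
  show "finite ?U" by (rule finite_gcomms)
  show U: "?U \<subseteq> carrier G" using cc by (simp add: conj_closed_def)
  show "inv y \<otimes> x \<otimes> y \<in> ?U" if "x \<in> ?U" "y \<in> ?U" for x y
    using conj_closedD(2)[OF cc that(1)] U that(2) by blast
  fix c assume "c \<in> ?U"
  then obtain x y where xy: "c = gcomm x y" "x \<in> W" "y \<in> W" by blast
  have xyc: "x \<in> carrier G" "y \<in> carrier G" using xy W_carrier by auto
  have cc: "c \<in> carrier G" using xy xyc by simp
  show "\<exists>ys. set ys \<subseteq> ?U \<and> inv c = list_prod ys"
  proof (intro exI conjI)
    show "set [gcomm y x] \<subseteq> ?U" using xy by auto
    show "inv c = list_prod [gcomm y x]" using inv_gcomm xyc xy by simp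
  qed
  have "c \<in> W" unfolding xy(1)
    using comm_sub_incl[OF xy(2,3)] comm_sub_subset_left[OF W_normal normal_subset[OF W_normal]] by blast
  from power_central[OF this] obtain k :: nat
    where k: "0 < k" "inv y \<otimes> c [^] k \<otimes> y = c [^] k" using xy by blast
  obtain j where j: "k = Suc j" using k by (cases k) auto
  let ?d = "gcomm (inv y \<otimes> x \<otimes> y) y"
  have d: "?d = inv y \<otimes> c \<otimes> y" unfolding xy(1) using xyc by (simp add: gcomm_def inv_mult_group m_assoc)
  have dc: "?d \<in> carrier G" using xyc by simp
  have cd: "c \<otimes> ?d = gcomm x (y \<otimes> y)"
    unfolding d using gcomm_mult_right[OF xyc(1,2,2)] xy(1) by simp
  have "c [^] Suc k = c \<otimes> c [^] k" by (rule nat_pow_Suc2[OF cc])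
  also have "\<dots> = c \<otimes> ?d [^] k" unfolding d conj_nat_pow[OF cc xyc(2)] k(2) ..
  also have "\<dots> = c \<otimes> (?d \<otimes> ?d [^] j)" unfolding j nat_pow_Suc2[OF dc] ..
  also have "\<dots> = (c \<otimes> ?d) \<otimes> ?d [^] j" using cc dc by (simp add: m_assoc)
  also have "\<dots> = list_prod (gcomm x (y \<otimes> y) # replicate j ?d)"
    unfolding cd by (simp add: list_prod_replicate[OF dc])
  finally have p: "c [^] Suc k = list_prod (gcomm x (y \<otimes> y) # replicate j ?d)" .
  have "inv y \<otimes> x \<otimes> y \<in> W" "y \<otimes> y \<in> W"
    using normal_conj(1)[OF W_normal xy(2) xyc(2)] subgroup.m_closed[OF W_subgroup] xy by auto
  then have "gcomm x (y \<otimes> y) \<in> ?U" "?d \<in> ?U" using xy by blast+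
  then have "set (gcomm x (y \<otimes> y) # replicate j ?d) \<subseteq> ?U"
    by (simp add: set_replicate_conv_if del: mem_Collect_eq)
  moreover have "length (gcomm x (y \<otimes> y) # replicate j ?d) < Suc k" using j by simp
  ultimately show "\<exists>n ys. set ys \<subseteq> ?U \<and> length ys < n \<and> c [^] n = list_prod ys" using p by blast
qed

definition torsion_part where
  "torsion_part = {x \<in> W. \<exists>n::nat. 0 < n \<and> x [^] n = \<one>}"

lemma torsion_part_normal: "torsion_part \<lhd> G"
proof (rule normalI_conj)
  show "subgroup torsion_part G"
  proof
    show "torsion_part \<subseteq> carrier G" using W_carrier by (auto simp: torsion_part_def)
    show "\<one> \<in> torsion_part"
      using subgroup.one_closed[OF W_subgroup] by (auto simp: torsion_part_def intro!: exI[of _ 1])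
    show "inv x \<in> torsion_part" if "x \<in> torsion_part" for x
      using that subgroup.m_inv_closed[OF W_subgroup] W_carrier
      by (auto simp: torsion_part_def nat_pow_inv)
    fix x y assume x: "x \<in> torsion_part" and y: "y \<in> torsion_part"
    have W: "x \<in> W" "y \<in> W" using x y by (auto simp: torsion_part_def)
    \<comment> \<open>All \<open>W\<close>-conjugates of \<open>x\<close> and \<open>y\<close>.
      Since a^g = a[a,g] and \<open>W\<close> has finitely many commutators, \<open>C\<close> is
      finite; Dietzmann's theorem puts \<open>x \<otimes> y\<close> into a finite subgroup.\<close>
    define C where "C = (\<lambda>(x, g). inv g \<otimes> x \<otimes> g) ` ({x, y} \<times> W)"
    have xT: "a \<in> W" "a \<in> carrier G" "\<exists>n::nat. 0 < n \<and> a [^] n = \<one>" if "a \<in> {x, y}" for a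
      using that x y W_carrier by (auto simp: torsion_part_def)
    have CE: "\<exists>a g. u = inv g \<otimes> a \<otimes> g \<and> a \<in> {x, y} \<and> g \<in> W" if "u \<in> C" for u
      using that by (auto simp: C_def)
    have CI: "inv g \<otimes> a \<otimes> g \<in> C" if "a \<in> {x, y}" "g \<in> W" for a g
      using that unfolding C_def by (intro image_eqI[of _ _ "(a, g)"]) auto
    have CW: "C \<subseteq> W"
      using CE xT(1) normal_conj(1)[OF W_normal] W_carrier by blast
    have "finite (generate G C)"
    proof (rule dietzmann)
      have "C \<subseteq> (\<lambda>(a, c). a \<otimes> c) ` ({x, y} \<times> {gcomm x y | x y. x \<in> W \<and> y \<in> W})"
      proof
        fix u assume "u \<in> C"
        then obtain a g where u: "u = inv g \<otimes> a \<otimes> g" "a \<in> {x, y}" "g \<in> W" using CE by blast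
        have "a \<in> W" "a \<in> carrier G" "g \<in> carrier G" using u xT W_carrier by auto
        then have "u = a \<otimes> gcomm a g" using u(1) by (simp add: gcomm_def m_assoc)
        moreover have "gcomm a g \<in> {gcomm x y | x y. x \<in> W \<and> y \<in> W}"
          using \<open>a \<in> W\<close> u(3) by blast
        ultimately show "u \<in> (\<lambda>(a, c). a \<otimes> c) ` ({x, y} \<times> {gcomm x y | x y. x \<in> W \<and> y \<in> W})"
          using u(2) by (intro image_eqI[of _ _ "(a, gcomm a g)"]) auto
      qed
      moreover have "finite ({x, y} \<times> {gcomm x y | x y. x \<in> W \<and> y \<in> W})"
        using finite_gcomms by (intro finite_cartesian_product) auto
      ultimately show "finite C" using finite_surj by blast
      show "C \<subseteq> carrier G" using CW W_carrier by blast
      show "inv h \<otimes> u \<otimes> h \<in> C" if u: "u \<in> C" and h: "h \<in> C" for u h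
      proof -
        obtain a g where u: "u = inv g \<otimes> a \<otimes> g" "a \<in> {x, y}" "g \<in> W" using CE[OF u] by blast
        have hW: "h \<in> W" using h CW by blast
        have "inv h \<otimes> u \<otimes> h = inv (g \<otimes> h) \<otimes> a \<otimes> (g \<otimes> h)"
          unfolding u(1) by (rule conj_mult) (use u xT W_carrier hW in auto)
        then show ?thesis using CI[OF u(2) subgroup.m_closed[OF W_subgroup u(3) hW]] by simp
      qed
      show "\<exists>n::nat. 0 < n \<and> u [^] n = \<one>" if u: "u \<in> C" for u
      proof -
        obtain a g where u: "u = inv g \<otimes> a \<otimes> g" "a \<in> {x, y}" "g \<in> W" using CE[OF u] by blast
        obtain n :: nat where n: "0 < n" "a [^] n = \<one>" using xT(3)[OF u(2)] by blast
        have "u [^] n = \<one>"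
          unfolding u(1) using conj_nat_pow[OF xT(2)[OF u(2)] W_carrier[OF u(3)], of n] n W_carrier[OF u(3)]
          by simp
        then show ?thesis using n by blast
      qed
    qed
    moreover have "x \<otimes> y \<in> generate G C"
    proof (rule generate.eng)
      have "a \<in> generate G C" if "a \<in> {x, y}" for a
        using CI[OF that subgroup.one_closed[OF W_subgroup]] xT(2)[OF that] generate.incl by simp
      then show "x \<in> generate G C" "y \<in> generate G C" by auto
    qed
    moreover have "subgroup (generate G C) G"
      using CW W_carrier by (intro generate_is_subgroup) blast
    ultimately show "x \<otimes> y \<in> torsion_part"
      using finite_subgroup_torsion W subgroup.m_closed[OF W_subgroup] by (simp add: torsion_part_def)
  qed
  show "inv g \<otimes> x \<otimes> g \<in> torsion_part" if x: "x \<in> torsion_part" and g: "g \<in> carrier G" for x g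
  proof -
    obtain n :: nat where n: "0 < n" "x [^] n = \<one>" and W: "x \<in> W" using x by (auto simp: torsion_part_def)
    have "(inv g \<otimes> x \<otimes> g) [^] n = \<one>"
      using conj_nat_pow[OF W_carrier[OF W] g, of n] n g by simp
    then show ?thesis using n normal_conj(1)[OF W_normal W g] by (auto simp: torsion_part_def)
  qed
qed

lemma commutators_torsion: "comm_sub W W \<subseteq> torsion_part"
proof
  fix x assume x: "x \<in> comm_sub W W"
  have "x \<in> W" using x comm_sub_subset_left[OF W_normal normal_subset[OF W_normal]] by blast
  moreover have "subgroup (comm_sub W W) G"
    by (rule normal_imp_subgroup[OF comm_sub_normal[OF W_normal W_normal]])
  ultimately show "x \<in> torsion_part"
    using finite_subgroup_torsion[OF _ finite_commutator_subgroup x] by (simp add: torsion_part_def)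
qed

text \<open>This is the torsion-freeness of the quotient of \<open>W\<close> by its torsion
  part.\<close>

lemma torsion_part_isolated:
  assumes "x \<in> W" "0 < n" "x [^] (n::nat) \<in> torsion_part"
  shows "x \<in> torsion_part"
proof -
  obtain k :: nat where "0 < k" "(x [^] n) [^] k = \<one>" using assms by (auto simp: torsion_part_def)
  then have "0 < n * k" "x [^] (n * k) = \<one>" using assms W_carrier by (auto simp: nat_pow_pow)
  then show ?thesis using assms(1) unfolding torsion_part_def by blast
qed

lemma finite_if_torsion:
  assumes "V \<subseteq> torsion_part"
  shows "finite W"
  unfolding W_def
proof (rule dietzmann[OF V(1) V_carrier])
  show "inv y \<otimes> x \<otimes> y \<in> V" if "x \<in> V" "y \<in> V" for x y
    using conj_closedD(2)[OF V(2) that(1)] V_carrier that(2) by blast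
qed (use assms in \<open>auto simp: torsion_part_def\<close>)

end
end

subsection \<open>Outer commutators of normal subgroups\<close>

context group
begin

section \<open>Cosets, and powers of commutators modulo a normal subgroup\<close>

lemma rcoset_eqI:
  assumes "subgroup Z G" "q \<in> carrier G" "z \<in> Z" "p = z \<otimes> q"
  shows "Z #> p = Z #> q"
proof -
  have "p \<in> Z #> q" using assms by (auto simp: r_coset_def)
  then show ?thesis using repr_independence assms by blast
qed

lemma rcoset_eqD:
  assumes "subgroup Z G" "p \<in> carrier G" "Z #> p = Z #> q"
  obtains z where "z \<in> Z" "p = z \<otimes> q"
proof -
  have "p \<in> Z #> q" using rcos_self[OF assms(2,1)] assms(3) by simp
  then show ?thesis using that by (auto simp: r_coset_def)
qed

lemma rcoset_one_iff:
  assumes "subgroup Z G" "p \<in> carrier G"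
  shows "Z #> p = Z \<longleftrightarrow> p \<in> Z"
  using assms coset_join1 coset_join2 subgroup.subset by metis

lemma rcoset_group_hom:
  assumes "Z \<lhd> G"
  shows "group_hom G (G Mod Z) (\<lambda>x. Z #> x)"
  using normal.r_coset_hom_Mod[OF assms] normal.factorgroup_is_group[OF assms]
  by (simp add: group_hom_def group_hom_axioms_def)

lemma rcoset_inv:
  assumes "Z \<lhd> G" "p \<in> carrier G" "q \<in> carrier G" "Z #> p = Z #> q"
  shows "Z #> inv p = Z #> inv q"
  using group_hom.hom_inv[OF rcoset_group_hom[OF assms(1)]] assms(2-) by metis

lemma rcoset_pow:
  assumes "Z \<lhd> G" "p \<in> carrier G" "q \<in> carrier G" "Z #> p = Z #> q"
  shows "Z #> p [^] (n::nat) = Z #> q [^] n"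
proof -
  interpret h: group_hom G "G Mod Z" "\<lambda>x. Z #> x" by (rule rcoset_group_hom[OF assms(1)])
  show ?thesis using h.hom_nat_pow assms by simp
qed

lemma gcomm_pow:
  assumes "a \<in> carrier G" "b \<in> carrier G" "gcomm a b \<otimes> a = a \<otimes> gcomm a b"
  shows "gcomm (a [^] (n::nat)) b = gcomm a b [^] n"
proof (induction n)
  case 0
  then show ?case using assms by (simp add: gcomm_def)
next
  case (Suc n)
  have "gcomm a b [^] n \<otimes> a = a \<otimes> gcomm a b [^] n"
    using assms by (intro group_commutes_pow) auto
  then have "inv a \<otimes> gcomm a b [^] n \<otimes> a = gcomm a b [^] n"
    using assms by (simp add: m_assoc)
  then show ?case using Suc assms by (simp add: gcomm_mult_left)
qed

lemma gcomm_pow_mod: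
  assumes Z: "Z \<lhd> G" and c: "a \<in> carrier G" "b \<in> carrier G" "z \<in> carrier G"
    and "p = z \<otimes> a [^] (n::nat)" "gcomm z b \<in> Z" "gcomm (gcomm a b) a \<in> Z"
  shows "Z #> gcomm p b = Z #> gcomm a b [^] n"
proof -
  interpret h: group_hom G "G Mod Z" "\<lambda>x. Z #> x" by (rule rcoset_group_hom[OF Z])
  have sZ: "subgroup Z G" by (rule normal_imp_subgroup[OF Z])
  have hc: "Z #> gcomm x y = h.gcomm (Z #> x) (Z #> y)"
    if "x \<in> carrier G" "y \<in> carrier G" for x y
    using that by (simp add: gcomm_def h.gcomm_def)
  have one: "\<one>\<^bsub>G Mod Z\<^esub> = Z" by simp
  \<comment> \<open>With c = [a,b] and q = ac one has ca = q[c,a]. As [c,a] lies in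
    \<open>Z\<close>, the cosets of \<open>a\<close> and c commute, so \<open>gcomm_pow\<close>
    applies in the quotient.\<close>
  define q where "q = a \<otimes> gcomm a b"
  have q: "q \<in> carrier G" using c by (simp add: q_def)
  have "gcomm a b \<otimes> a = (q \<otimes> gcomm (gcomm a b) a \<otimes> inv q) \<otimes> q"
    using c unfolding q_def by (simp add: gcomm_def m_assoc inv_mult_group)
  moreover have "q \<otimes> gcomm (gcomm a b) a \<otimes> inv q \<in> Z"
    by (rule normal_conj(2)[OF Z assms(7) q])
  ultimately have "Z #> (gcomm a b \<otimes> a) = Z #> (a \<otimes> gcomm a b)"
    using q unfolding q_def[symmetric] by (intro rcoset_eqI[OF sZ]) auto
  then have "h.gcomm (Z #> a) (Z #> b) \<otimes>\<^bsub>G Mod Z\<^esub> (Z #> a) = (Z #> a) \<otimes>\<^bsub>G Mod Z\<^esub> h.gcomm (Z #> a) (Z #> b)"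
    using c hc[of a b] h.hom_mult[of "gcomm a b" a] h.hom_mult[of a "gcomm a b"] by simp
  then have "h.gcomm ((Z #> a) [^]\<^bsub>G Mod Z\<^esub> n) (Z #> b) = h.gcomm (Z #> a) (Z #> b) [^]\<^bsub>G Mod Z\<^esub> n"
    using c h.hom_closed by (intro h.gcomm_pow) blast+
  then have 1: "Z #> gcomm (a [^] n) b = Z #> gcomm a b [^] n"
    using c hc[of "a [^] n" b] hc[of a b] h.hom_nat_pow[of a n] h.hom_nat_pow[of "gcomm a b" n] by simp
  have "gcomm p b = (inv (a [^] n) \<otimes> gcomm z b \<otimes> a [^] n) \<otimes> gcomm (a [^] n) b"
    using assms by (simp add: gcomm_mult_left)
  then have "Z #> gcomm p b = Z #> gcomm (a [^] n) b"
    using normal_conj(1)[OF Z assms(6), of "a [^] n"] c by (intro rcoset_eqI[OF sZ]) auto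
  with 1 show ?thesis by simp
qed

section \<open>Outer commutators of subgroups (\<open>osub\<close>) and of elements
  (\<open>oval\<close>)\<close>

primrec osub :: "oc \<Rightarrow> (nat \<Rightarrow> 'a set) \<Rightarrow> 'a set" where
  "osub (OVar i) M = M i"
| "osub (OComm a b) M = comm_sub (osub a M) (osub b M)"

primrec oval :: "oc \<Rightarrow> (nat \<Rightarrow> 'a) \<Rightarrow> 'a" where
  "oval (OVar i) x = x i"
| "oval (OComm a b) x = gcomm (oval a x) (oval b x)"

lemma osub_normal: "(\<And>m. M m \<lhd> G) \<Longrightarrow> osub t M \<lhd> G"
  by (induction t) (auto intro: comm_sub_normal)

lemma osub_mono: "(\<And>m. m \<in> oc_vars t \<Longrightarrow> M m \<subseteq> M' m) \<Longrightarrow> osub t M \<subseteq> osub t M'"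
proof (induction t)
  case (OComm a b)
  then show ?case unfolding osub.simps by (intro comm_sub_mono) auto
qed auto

lemma osub_cong: "(\<And>m. m \<in> oc_vars t \<Longrightarrow> M m = M' m) \<Longrightarrow> osub t M = osub t M'"
  by (induction t) auto

lemma oval_cong: "(\<And>m. m \<in> oc_vars t \<Longrightarrow> x m = y m) \<Longrightarrow> oval t x = oval t y"
  by (induction t) auto

lemma osub_upd_notin [simp]: "m \<notin> oc_vars t \<Longrightarrow> osub t (M(m := A)) = osub t M"
  by (rule osub_cong) auto

lemma oval_upd_notin [simp]: "m \<notin> oc_vars t \<Longrightarrow> oval t (x(m := y)) = oval t x"
  by (rule oval_cong) auto

lemma oval_in_osub: "(\<And>m. m \<in> oc_vars t \<Longrightarrow> x m \<in> M m) \<Longrightarrow> oval t x \<in> osub t M"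
  by (induction t) (auto intro: comm_sub_incl)

lemma oval_closed: "(\<And>m. m \<in> oc_vars t \<Longrightarrow> x m \<in> carrier G) \<Longrightarrow> oval t x \<in> carrier G"
  by (induction t) auto

lemma osub_subset_label:
  assumes "\<And>m. M m \<lhd> G"
  shows "i \<in> oc_vars t \<Longrightarrow> osub t M \<subseteq> M i"
proof (induction t)
  case (OComm a b)
  have n: "osub a M \<lhd> G" "osub b M \<lhd> G" using assms by (auto intro: osub_normal)
  have "comm_sub (osub a M) (osub b M) \<subseteq> osub a M" "comm_sub (osub a M) (osub b M) \<subseteq> osub b M"
    using n comm_sub_subset_left comm_sub_subset_right normal_subset by blast+
  then show ?case using OComm by auto
qed auto

lemma conj_oval:
  assumes "g \<in> carrier G"
  shows "(\<And>m. m \<in> oc_vars t \<Longrightarrow> x m \<in> carrier G) \<Longrightarrow>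
    inv g \<otimes> oval t x \<otimes> g = oval t (\<lambda>m. inv g \<otimes> x m \<otimes> g)"
  by (induction t) (auto simp: conj_gcomm assms oval_closed)

text \<open>The three subgroup lemma iterated along the tree: a commutator with \<open>U\<close>
  from outside is distributed over the leaves. Distinct branches have disjoint variables, so
  relabelling a leaf changes only one branch.\<close>

lemma comm_sub_osub_subset:
  assumes M: "\<And>m. M m \<lhd> G" and U: "U \<lhd> G"
  shows "oc_wf b \<Longrightarrow> Y \<lhd> G \<Longrightarrow>
    (\<And>m. m \<in> oc_vars b \<Longrightarrow> osub b (M(m := comm_sub U (M m))) \<subseteq> Y) \<Longrightarrow>
    comm_sub U (osub b M) \<subseteq> Y"
proof (induction b arbitrary: Y)
  case (OVar i)
  then show ?case by simp
next
  case (OComm c d)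
  let ?C = "osub c M" and ?D = "osub d M"
  let ?M = "\<lambda>m. M(m := comm_sub U (M m))"
  have M': "\<And>m k. ?M m k \<lhd> G" using M U by (simp add: comm_sub_normal)
  have n: "?C \<lhd> G" "?D \<lhd> G" using M by (auto intro: osub_normal)
  have n': "\<And>m. osub c (?M m) \<lhd> G" "\<And>m. osub d (?M m) \<lhd> G"
    by (rule osub_normal, rule M')+
  have sY: "subgroup Y G" using OComm.prems normal_imp_subgroup by blast
  have wf: "oc_wf c" "oc_wf d" and dj: "oc_vars c \<inter> oc_vars d = {}" using OComm.prems by auto
  have U1: "comm_sub U ?C \<subseteq> carrier G" "comm_sub U ?D \<subseteq> carrier G"
    using U n comm_sub_normal normal_subset by blast+
  \<comment> \<open>The induction hypothesis for \<open>c\<close> is used with the centralizer of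
    the other branch modulo \<open>Y\<close> as target; this is why \<open>Y\<close> is arbitrary in
    the induction.\<close>
  have "comm_sub U ?C \<subseteq> centralizer_mod Y ?D"
  proof (rule OComm.IH(1)[OF wf(1) centralizer_mod_normal[OF OComm.prems(2) normal_conj_closed[OF n(2)]]])
    fix m assume m: "m \<in> oc_vars c"
    then have "m \<notin> oc_vars d" using dj by blast
    then have "comm_sub (osub c (?M m)) ?D \<subseteq> Y" using OComm.prems(3)[of m] m by (simp del: fun_upd_apply)
    then show "osub c (?M m) \<subseteq> centralizer_mod Y ?D"
      using comm_sub_subset_iff[OF sY normal_subset[OF n'(1)]] by blast
  qed
  then have 1: "comm_sub (comm_sub U ?C) ?D \<subseteq> Y" using comm_sub_subset_iff[OF sY U1(1)] by blast
  have "comm_sub U ?D \<subseteq> centralizer_mod Y ?C"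
  proof (rule OComm.IH(2)[OF wf(2) centralizer_mod_normal[OF OComm.prems(2) normal_conj_closed[OF n(1)]]])
    fix m assume m: "m \<in> oc_vars d"
    then have "m \<notin> oc_vars c" using dj by blast
    then have "comm_sub ?C (osub d (?M m)) \<subseteq> Y" using OComm.prems(3)[of m] m by (simp del: fun_upd_apply)
    then show "osub d (?M m) \<subseteq> centralizer_mod Y ?C"
      using comm_sub_subset_iff_right[OF sY normal_subset[OF n(1)] normal_subset[OF n'(2)]] by blast
  qed
  then have 2: "comm_sub (comm_sub U ?D) ?C \<subseteq> Y" using comm_sub_subset_iff[OF sY U1(2)] by blast
  show ?case using three_subgroups[OF U n OComm.prems(2) 1 2] by simp
qed

text \<open>Compatibility with powers in entry \<open>i\<close>. The obstruction comes from
  commutators of \<open>M i\<close> with the other labels, and the last hypothesis places all of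
  these in \<open>Z\<close>.\<close>

lemma oval_pow_mod:
  assumes M: "\<And>m. M m \<lhd> G" and y: "y \<in> M i"
  shows "oc_wf t \<Longrightarrow> Z \<lhd> G \<Longrightarrow> i \<in> oc_vars t \<Longrightarrow>
    (\<And>m. m \<in> oc_vars t \<Longrightarrow> x m \<in> M m) \<Longrightarrow>
    (\<And>m. m \<in> oc_vars t - {i} \<Longrightarrow> osub t (M(m := comm_sub (M i) (M m))) \<subseteq> Z) \<Longrightarrow>
    Z #> oval t (x(i := y [^] (n::nat))) = Z #> oval t (x(i := y)) [^] n"
proof (induction t arbitrary: Z)
  case (OVar j)
  then show ?case by simp
next
  case (OComm a b)
  let ?M = "\<lambda>m. M(m := comm_sub (M i) (M m))"
  \<comment> \<open>Stated for a pair \<open>p\<close>, \<open>q\<close> with \<open>i\<close> in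
    \<open>p\<close>, so that it serves for both orders of the two branches.\<close>
  have key: "Z #> gcomm (oval p (x(i := y [^] n))) (oval q x) =
      Z #> gcomm (oval p (x(i := y))) (oval q x) [^] n"
    if IH: "\<And>Z. Z \<lhd> G \<Longrightarrow>
        (\<And>m. m \<in> oc_vars p - {i} \<Longrightarrow> osub p (?M m) \<subseteq> Z) \<Longrightarrow>
        Z #> oval p (x(i := y [^] n)) = Z #> oval p (x(i := y)) [^] n"
      and i: "i \<in> oc_vars p" and xp: "\<And>m. m \<in> oc_vars p \<Longrightarrow> x m \<in> M m"
      and xq: "\<And>m. m \<in> oc_vars q \<Longrightarrow> x m \<in> M m"
      and dj: "oc_vars p \<inter> oc_vars q = {}" and wf: "oc_wf q"
      and hyp: "\<And>m. m \<in> oc_vars p \<union> oc_vars q - {i} \<Longrightarrow>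
        comm_sub (osub p (?M m)) (osub q (?M m)) \<subseteq> Z"
    for p q
  proof -
    let ?P = "osub p M" and ?Q = "osub q M"
    have Z: "Z \<lhd> G" using OComm.prems by blast
    have sZ: "subgroup Z G" using Z normal_imp_subgroup by blast
    have n: "?P \<lhd> G" "?Q \<lhd> G" using M by (auto intro: osub_normal)
    have M': "\<And>m k. ?M m k \<lhd> G" using M by (simp add: comm_sub_normal)
    have n': "\<And>m. osub p (?M m) \<lhd> G" "\<And>m. osub q (?M m) \<lhd> G"
      by (rule osub_normal, rule M')+
    let ?a = "oval p (x(i := y))" and ?b = "oval q x" and ?c = "oval p (x(i := y [^] n))"
    have a: "?a \<in> ?P" using xp y by (intro oval_in_osub) auto
    have b: "?b \<in> ?Q" using xq by (intro oval_in_osub) auto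
    have "y [^] n \<in> M i" using M[of i] y
      by (simp add: normal_imp_subgroup subgroup_nat_pow_closed)
    then have c: "?c \<in> ?P" using xp by (intro oval_in_osub) auto
    have car: "?a \<in> carrier G" "?b \<in> carrier G" "?c \<in> carrier G"
      using a b c n normal_subset by blast+
    let ?Zp = "centralizer_mod Z ?Q"
    have Zp: "?Zp \<lhd> G" by (rule centralizer_mod_normal[OF Z normal_conj_closed[OF n(2)]])
    \<comment> \<open>By induction \<open>p\<close> respects the power up to an element
      \<open>z\<close> of \<open>?Zp\<close>, that is, one which commutes with \<open>?b\<close>
      modulo \<open>Z\<close>.\<close>
    have "?Zp #> ?c = ?Zp #> ?a [^] n"
    proof (rule IH[OF Zp])
      fix m assume m: "m \<in> oc_vars p - {i}"
      then have "m \<notin> oc_vars q" using dj by blast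
      then have "comm_sub (osub p (?M m)) ?Q \<subseteq> Z" using hyp[of m] m by (simp del: fun_upd_apply)
      then show "osub p (?M m) \<subseteq> ?Zp"
        using comm_sub_subset_iff[OF sZ normal_subset[OF n'(1)]] by blast
    qed
    then obtain z where z: "z \<in> ?Zp" "?c = z \<otimes> ?a [^] n"
      using rcoset_eqD[OF normal_imp_subgroup[OF Zp] car(3)] by blast
    have zb: "z \<in> carrier G" "gcomm z ?b \<in> Z" using z(1) b by (auto simp: centralizer_mod_def)
    \<comment> \<open>Since \<open>?a\<close> lies both in \<open>M i\<close> and in
      \<open>?P\<close>, this makes [a,b] commute with \<open>?a\<close> modulo \<open>Z\<close>, as
      \<open>gcomm_pow_mod\<close> demands.\<close>
    have "comm_sub (M i) ?Q \<subseteq> centralizer_mod Z ?P"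
    proof (rule comm_sub_osub_subset[of M, OF M M wf centralizer_mod_normal[OF Z normal_conj_closed[OF n(1)]]])
      fix m assume m: "m \<in> oc_vars q"
      then have "m \<notin> oc_vars p" "m \<noteq> i" using dj i by blast+
      then have "comm_sub ?P (osub q (?M m)) \<subseteq> Z" using hyp[of m] m by (simp del: fun_upd_apply)
      then show "osub q (?M m) \<subseteq> centralizer_mod Z ?P"
        using comm_sub_subset_iff_right[OF sZ normal_subset[OF n(1)] normal_subset[OF n'(2)]] by blast
    qed
    moreover have "?a \<in> M i" using a osub_subset_label[of M, OF M i] by blast
    ultimately have "gcomm (gcomm ?a ?b) ?a \<in> Z"
      using comm_sub_incl[OF _ b] a unfolding centralizer_mod_def by blast
    from gcomm_pow_mod[OF Z car(1,2) zb(1) z(2) zb(2) this] show ?thesis .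
  qed
  have wf: "oc_wf a" "oc_wf b" and dj: "oc_vars a \<inter> oc_vars b = {}" using OComm.prems by auto
  have Z: "Z \<lhd> G" using OComm.prems by blast
  have hyp: "\<And>m. m \<in> oc_vars a \<union> oc_vars b - {i} \<Longrightarrow>
        comm_sub (osub a (?M m)) (osub b (?M m)) \<subseteq> Z"
    using OComm.prems(5) unfolding osub.simps oc_vars.simps .
  have x: "\<And>m. m \<in> oc_vars a \<union> oc_vars b \<Longrightarrow> x m \<in> M m"
    using OComm.prems(4) by simp
  have yc: "y \<in> carrier G" using y M normal_subset by blast
  have xc: "\<And>m. m \<in> oc_vars a \<union> oc_vars b \<Longrightarrow> x m \<in> carrier G"
    using x M normal_subset by blast
  have xa: "\<And>m. m \<in> oc_vars a \<Longrightarrow> x m \<in> M m" and xb: "\<And>m. m \<in> oc_vars b \<Longrightarrow> x m \<in> M m"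
    using x by simp_all
  show ?case
  proof (cases "i \<in> oc_vars a")
    case True
    then have ib: "i \<notin> oc_vars b" using dj by blast
    show ?thesis
      unfolding oval.simps oval_upd_notin[OF ib]
    proof (rule key[OF _ True xa xb dj wf(2) hyp])
      show "Y #> oval a (x(i := y [^] n)) = Y #> oval a (x(i := y)) [^] n"
        if "Y \<lhd> G" "\<And>m. m \<in> oc_vars a - {i} \<Longrightarrow> osub a (?M m) \<subseteq> Y" for Y
        by (rule OComm.IH(1)[OF wf(1) that(1) True xa that(2)])
    qed
  next
    case False
    have dj': "oc_vars b \<inter> oc_vars a = {}" using dj by blast
    from False have ib: "i \<in> oc_vars b" using OComm.prems by simp
    have M': "\<And>m k. ?M m k \<lhd> G" using M by (simp add: comm_sub_normal)
    have car': "\<And>m. osub a (?M m) \<subseteq> carrier G" "\<And>m. osub b (?M m) \<subseteq> carrier G"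
      by (rule normal_subset, rule osub_normal, rule M')+
    have hyp': "comm_sub (osub b (?M m)) (osub a (?M m)) \<subseteq> Z"
      if "m \<in> oc_vars b \<union> oc_vars a - {i}" for m
      using hyp[of m] that unfolding comm_sub_commute[OF car', of m m] by blast
    let ?b = "oval b (x(i := y))" and ?a = "oval a x" and ?c = "oval b (x(i := y [^] n))"
    have car: "?a \<in> carrier G" "?b \<in> carrier G" "?c \<in> carrier G"
      using xc yc by (auto intro!: oval_closed)
    \<comment> \<open>When \<open>i\<close> occurs in the right branch, the commutator is reversed
      and inverses are taken afterwards.\<close>
    have "Z #> gcomm ?c ?a = Z #> gcomm ?b ?a [^] n"
    proof (rule key[OF _ ib xb xa dj' wf(1) hyp'])
      show "Y #> oval b (x(i := y [^] n)) = Y #> oval b (x(i := y)) [^] n"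
        if "Y \<lhd> G" "\<And>m. m \<in> oc_vars b - {i} \<Longrightarrow> osub b (?M m) \<subseteq> Y" for Y
        by (rule OComm.IH(2)[OF wf(2) that(1) ib xb that(2)])
    qed
    then have "Z #> inv (gcomm ?c ?a) = Z #> inv (gcomm ?b ?a [^] n)"
      using car by (intro rcoset_inv[OF Z]) auto
    moreover have "inv (gcomm ?b ?a [^] n) = gcomm ?a ?b [^] n"
      using nat_pow_inv[of "gcomm ?b ?a" n] inv_gcomm[OF car(2,1)] car by simp
    ultimately show ?thesis
      unfolding oval.simps oval_upd_notin[OF False] inv_gcomm[OF car(3,1)] by simp
  qed
qed

text \<open>Passing from generators to generated subgroups is done one branch at a time: first in
  \<open>a\<close>, against single values of \<open>b\<close>, then in \<open>b\<close>, against all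
  of \<open>osub a\<close>. Each time the elements allowed form a normal subgroup, namely a
  centralizer modulo \<open>Z\<close>.\<close>

lemma osub_generate_subset:
  assumes S: "\<And>m. conj_closed (S m)"
  shows "oc_wf t \<Longrightarrow> Z \<lhd> G \<Longrightarrow>
    (\<And>x. (\<And>m. m \<in> oc_vars t \<Longrightarrow> x m \<in> S m) \<Longrightarrow> oval t x \<in> Z) \<Longrightarrow>
    osub t (\<lambda>m. generate G (S m)) \<subseteq> Z"
proof (induction t arbitrary: Z)
  case (OVar i)
  have "S i \<subseteq> Z"
  proof
    fix s assume "s \<in> S i"
    then show "s \<in> Z" using OVar.prems(3)[of "\<lambda>_. s"] by simp
  qed
  then show ?case using OVar.prems generate_subgroup_incl normal_imp_subgroup by simp blast
next
  case (OComm a b)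
  let ?M = "\<lambda>m. generate G (S m)"
  have M: "\<And>m. ?M m \<lhd> G" using S generate_conj_closed_normal by blast
  have Z: "Z \<lhd> G" and sZ: "subgroup Z G" using OComm.prems normal_imp_subgroup by blast+
  have wf: "oc_wf a" "oc_wf b" and dj: "oc_vars a \<inter> oc_vars b = {}" using OComm.prems by auto
  have n: "osub a ?M \<lhd> G" "osub b ?M \<lhd> G" using M by (auto intro: osub_normal)
  define V where "V = {oval b x | x. \<forall>m\<in>oc_vars b. x m \<in> S m}"
  have V: "conj_closed V"
    unfolding conj_closed_def
  proof (intro conjI ballI)
    show "V \<subseteq> carrier G" using conj_closedD(1)[OF S] unfolding V_def by (auto intro!: oval_closed)
    fix v g assume v: "v \<in> V" and g: "g \<in> carrier G"
    then obtain x where x: "v = oval b x" "\<forall>m\<in>oc_vars b. x m \<in> S m" by (auto simp: V_def)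
    have "inv g \<otimes> v \<otimes> g = oval b (\<lambda>m. inv g \<otimes> x m \<otimes> g)"
      unfolding x(1) using x(2) conj_closedD(1)[OF S] by (intro conj_oval[OF g]) auto
    then show "inv g \<otimes> v \<otimes> g \<in> V"
      unfolding V_def using x(2) conj_closedD(2)[OF S _ g] by blast
  qed
  have "osub a ?M \<subseteq> centralizer_mod Z V"
  proof (rule OComm.IH(1)[OF wf(1) centralizer_mod_normal[OF Z V]])
    fix x assume x: "\<And>m. m \<in> oc_vars a \<Longrightarrow> x m \<in> S m"
    have "gcomm (oval a x) (oval b x') \<in> Z" if x': "\<forall>m\<in>oc_vars b. x' m \<in> S m" for x'
    proof -
      \<comment> \<open>Disjointness of the variables lets the two assignments be merged into
        one.\<close>
      let ?y = "\<lambda>m. if m \<in> oc_vars a then x m else x' m"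
      have "oval (OComm a b) ?y \<in> Z" using x x' by (intro OComm.prems(3)) auto
      moreover have "oval a ?y = oval a x" by (rule oval_cong) simp
      moreover have "oval b ?y = oval b x'" using dj by (intro oval_cong) auto
      ultimately show ?thesis by simp
    qed
    moreover have "oval a x \<in> carrier G" using x conj_closedD(1)[OF S] by (intro oval_closed) auto
    ultimately show "oval a x \<in> centralizer_mod Z V" by (auto simp: centralizer_mod_def V_def)
  qed
  then have a: "\<And>g v. g \<in> osub a ?M \<Longrightarrow> v \<in> V \<Longrightarrow> gcomm g v \<in> Z"
    by (auto simp: centralizer_mod_def)
  have "osub b ?M \<subseteq> centralizer_mod Z (osub a ?M)"
  proof (rule OComm.IH(2)[OF wf(2) centralizer_mod_normal[OF Z normal_conj_closed[OF n(1)]]])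
    fix x assume x: "\<And>m. m \<in> oc_vars b \<Longrightarrow> x m \<in> S m"
    then have v: "oval b x \<in> V" by (auto simp: V_def)
    have vc: "oval b x \<in> carrier G" using v V conj_closedD by blast
    have "gcomm (oval b x) g \<in> Z" if "g \<in> osub a ?M" for g
    proof -
      have "g \<in> carrier G" using that n normal_subset by blast
      then show ?thesis
        using subgroup.m_inv_closed[OF sZ a[OF that v]] inv_gcomm[OF _ vc] by simp
    qed
    then show "oval b x \<in> centralizer_mod Z (osub a ?M)" using vc by (simp add: centralizer_mod_def)
  qed
  then show ?case using comm_sub_subset_iff_right[OF sZ] n normal_subset by simp
qed

section \<open>The derived series of a normal subgroup inside outer commutators\<close>

primrec derived_iter :: "nat \<Rightarrow> 'a set \<Rightarrow> 'a set" where
  "derived_iter 0 A = A"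
| "derived_iter (Suc l) A = comm_sub (derived_iter l A) (derived_iter l A)"

lemma derived_iter_normal: "A \<lhd> G \<Longrightarrow> derived_iter l A \<lhd> G"
  by (induction l) (auto intro: comm_sub_normal)

lemma derived_iter_antimono:
  assumes "A \<lhd> G" "k \<le> l"
  shows "derived_iter l A \<subseteq> derived_iter k A"
  using assms(2)
proof (induction l rule: dec_induct)
  case (step l)
  then show ?case
    using comm_sub_subset_left[OF derived_iter_normal normal_subset[OF derived_iter_normal]] assms(1)
    by fastforce
qed simp

text \<open>Each commutator node costs one derived step, and \<open>size t\<close> bounds the depth
  of the tree.\<close>

lemma derived_iter_subset_osub:
  assumes A: "A \<lhd> G"
  shows "(\<And>m. m \<in> oc_vars t \<Longrightarrow> A \<subseteq> M m) \<Longrightarrow> size t \<le> l \<Longrightarrow> derived_iter l A \<subseteq> osub t M"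
proof (induction t arbitrary: l)
  case (OVar i)
  then show ?case using derived_iter_antimono[OF A, of 0 l] by auto
next
  case (OComm a b)
  then obtain k where k: "l = Suc k" "size a \<le> k" "size b \<le> k" by (cases l) auto
  have "derived_iter k A \<subseteq> osub a M" "derived_iter k A \<subseteq> osub b M"
    using OComm.IH(1)[of k] OComm.IH(2)[of k] OComm.prems k by auto
  then show ?case unfolding k(1) derived_iter.simps osub.simps by (rule comm_sub_mono)
qed

text \<open>Starting point of the climb up the derived series when \<open>K\<close> misses some
  variable of \<open>s\<close>: information about labels outside \<open>K\<close> is transferred to
  a label inside \<open>K\<close>, at the price of passing to a deep term of the derived series of
  \<open>A\<close>.\<close>

lemma osub_derived_iter_subset:
  assumes N: "\<And>m. N m \<lhd> G" and A: "A \<lhd> G" and AN: "\<And>m. m \<in> K \<Longrightarrow> A \<subseteq> N m"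
  shows "oc_wf s \<Longrightarrow> Z \<lhd> G \<Longrightarrow> \<not> oc_vars s \<subseteq> K \<Longrightarrow>
    (\<And>m. m \<in> oc_vars s - K \<Longrightarrow> osub s (N(m := comm_sub A (N m))) \<subseteq> Z) \<Longrightarrow>
    i \<in> oc_vars s \<inter> K \<Longrightarrow> size s \<le> l \<Longrightarrow> osub s (N(i := derived_iter l A)) \<subseteq> Z"
proof (induction s arbitrary: Z i l)
  case (OVar j)
  then show ?case by auto
next
  case (OComm a b)
  let ?N = "\<lambda>m. N(m := comm_sub A (N m))"
  let ?D = "\<lambda>l. derived_iter l A"
  have D: "\<And>l. ?D l \<lhd> G" using A by (rule derived_iter_normal)
  have D0: "\<And>l. ?D l \<subseteq> A" using derived_iter_antimono[OF A, of 0] by simp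
  have Z: "Z \<lhd> G" and sZ: "subgroup Z G" using OComm.prems normal_imp_subgroup by blast+
  have N': "\<And>m k. ?N m k \<lhd> G" using N A by (simp add: comm_sub_normal)
  have N'': "\<And>m l k. (N(m := ?D l)) k \<lhd> G" using N D by simp
  have key: "comm_sub (osub p (N(i := ?D l))) (osub q N) \<subseteq> Z"
    if IHp: "\<And>Z. Z \<lhd> G \<Longrightarrow> \<not> oc_vars p \<subseteq> K \<Longrightarrow>
        (\<And>m. m \<in> oc_vars p - K \<Longrightarrow> osub p (?N m) \<subseteq> Z) \<Longrightarrow> osub p (N(i := ?D l)) \<subseteq> Z"
      and IHq: "\<And>Z m k. Z \<lhd> G \<Longrightarrow> \<not> oc_vars q \<subseteq> K \<Longrightarrow>
        (\<And>m. m \<in> oc_vars q - K \<Longrightarrow> osub q (?N m) \<subseteq> Z) \<Longrightarrow> m \<in> oc_vars q \<inter> K \<Longrightarrow>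
        size q \<le> k \<Longrightarrow> osub q (N(m := ?D k)) \<subseteq> Z"
      and wf: "oc_wf q" and dj: "oc_vars p \<inter> oc_vars q = {}"
      and K: "\<not> oc_vars p \<union> oc_vars q \<subseteq> K" and i: "i \<in> oc_vars p"
      and hyp: "\<And>m. m \<in> oc_vars p \<union> oc_vars q - K \<Longrightarrow>
        comm_sub (osub p (?N m)) (osub q (?N m)) \<subseteq> Z"
      and l: "size p + size q < l"
    for p q
  proof -
    let ?P = "osub p N" and ?Q = "osub q N"
    have n: "?P \<lhd> G" "?Q \<lhd> G" using N by (auto intro: osub_normal)
    have n': "\<And>m. osub p (?N m) \<lhd> G" "\<And>m. osub q (?N m) \<lhd> G"
      by (rule osub_normal, rule N')+
    have n'': "\<And>m l. osub p (N(m := ?D l)) \<lhd> G" "\<And>m l. osub q (N(m := ?D l)) \<lhd> G"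
      by (rule osub_normal, rule N'')+
    show ?thesis
    proof (cases "oc_vars p \<subseteq> K")
      case False
      have "osub p (N(i := ?D l)) \<subseteq> centralizer_mod Z ?Q"
      proof (rule IHp[OF centralizer_mod_normal[OF Z normal_conj_closed[OF n(2)]] False])
        fix m assume m: "m \<in> oc_vars p - K"
        then have "m \<notin> oc_vars q" using dj by blast
        then have "comm_sub (osub p (?N m)) ?Q \<subseteq> Z" using hyp[of m] m by (simp del: fun_upd_apply)
        then show "osub p (?N m) \<subseteq> centralizer_mod Z ?Q"
          using comm_sub_subset_iff[OF sZ normal_subset[OF n'(1)]] by blast
      qed
      then show ?thesis using comm_sub_subset_iff[OF sZ normal_subset[OF n''(1)]] by blast
    next
      case True
      then have Kq: "\<not> oc_vars q \<subseteq> K" using K by blast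
      obtain k where k: "l = Suc k" "size p \<le> k" "size q \<le> k" using l by (cases l) auto
      let ?A = "?D k"
      \<comment> \<open>If all variables of \<open>p\<close> lie in \<open>K\<close>, then
        \<open>?P\<close> contains \<open>?A\<close>; so whatever centralizes \<open>?P\<close>
        modulo \<open>Z\<close> also centralizes \<open>?A\<close>.\<close>
      have AP: "?A \<subseteq> ?P" using derived_iter_subset_osub[OF A _ k(2)] AN True by blast
      have hypq: "osub q (?N m) \<subseteq> centralizer_mod Z ?P" if m: "m \<in> oc_vars q - K" for m
      proof -
        have "m \<notin> oc_vars p" using m dj by blast
        then have "comm_sub ?P (osub q (?N m)) \<subseteq> Z" using hyp[of m] m by (simp del: fun_upd_apply)
        then show ?thesis
          using comm_sub_subset_iff_right[OF sZ normal_subset[OF n(1)] normal_subset[OF n'(2)]]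
          by blast
      qed
      have ZP: "centralizer_mod Z ?P \<lhd> G"
        by (rule centralizer_mod_normal[OF Z normal_conj_closed[OF n(1)]])
      \<comment> \<open>Leaf by leaf: in \<open>K\<close> the label [A_k,N_m] lies in A_k and the
        induction hypothesis for \<open>q\<close> applies; outside \<open>K\<close> it lies in
        [A,N_m], which the hypothesis covers.\<close>
      have "comm_sub ?A ?Q \<subseteq> centralizer_mod Z ?P"
      proof (rule comm_sub_osub_subset[of N, OF N D wf ZP])
        fix m assume m: "m \<in> oc_vars q"
        show "osub q (N(m := comm_sub ?A (N m))) \<subseteq> centralizer_mod Z ?P"
        proof (cases "m \<in> K")
          case True
          have "osub q (N(m := comm_sub ?A (N m))) \<subseteq> osub q (N(m := ?A))"
            using comm_sub_subset_left[OF D normal_subset[OF N]] by (intro osub_mono) auto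
          also have "\<dots> \<subseteq> centralizer_mod Z ?P"
            using m True by (intro IHq[OF ZP Kq hypq _ k(3)]) auto
          finally show ?thesis .
        next
          case False
          have "osub q (N(m := comm_sub ?A (N m))) \<subseteq> osub q (?N m)"
            using comm_sub_mono[OF D0 subset_refl] by (intro osub_mono) auto
          also have "\<dots> \<subseteq> centralizer_mod Z ?P" using m False by (intro hypq) auto
          finally show ?thesis .
        qed
      qed
      also have "\<dots> \<subseteq> centralizer_mod Z ?A" using AP by (auto simp: centralizer_mod_def)
      finally have 1: "comm_sub ?A ?Q \<subseteq> centralizer_mod Z ?A" .
      have AQ: "comm_sub ?A ?Q \<lhd> G" by (rule comm_sub_normal[OF D n(2)])
      have 2: "comm_sub (comm_sub ?Q ?A) ?A \<subseteq> Z"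
        using 1 comm_sub_subset_iff[OF sZ normal_subset[OF AQ]]
          comm_sub_commute[OF normal_subset[OF D] normal_subset[OF n(2)], of k] by simp
      \<comment> \<open>Since \<open>l = Suc k\<close>, the term \<open>?D l\<close> is the
        commutator of \<open>?A\<close> with itself, and both premises of the three subgroup lemma
        are fact \<open>2\<close>.\<close>
      have "comm_sub ?Q (?D l) \<subseteq> Z"
        unfolding k(1) derived_iter.simps by (rule three_subgroups[OF n(2) D D Z 2 2])
      then have 3: "comm_sub (?D l) ?Q \<subseteq> Z"
        using comm_sub_commute[OF normal_subset[OF D] normal_subset[OF n(2)], of l] by simp
      have "osub p (N(i := ?D l)) \<subseteq> ?D l"
        using osub_subset_label[of "N(i := ?D l)" i p, OF N'' i] by simp
      then show ?thesis using 3 comm_sub_mono by blast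
    qed
  qed
  have wf: "oc_wf a" "oc_wf b" and dj: "oc_vars a \<inter> oc_vars b = {}" using OComm.prems by auto
  have hyp: "\<And>m. m \<in> oc_vars a \<union> oc_vars b - K \<Longrightarrow>
        comm_sub (osub a (?N m)) (osub b (?N m)) \<subseteq> Z"
    using OComm.prems(4) unfolding osub.simps oc_vars.simps .
  have iK: "i \<in> K" and l: "size a \<le> l" "size b \<le> l" "size a + size b < l"
    using OComm.prems by auto
  show ?case
  proof (cases "i \<in> oc_vars a")
    case True
    then have ib: "i \<notin> oc_vars b" using dj by blast
    show ?thesis
      unfolding osub.simps osub_upd_notin[OF ib]
    proof (rule key[OF _ _ wf(2) dj _ True hyp l(3)])
      show "osub a (N(i := ?D l)) \<subseteq> Y"
        if "Y \<lhd> G" "\<not> oc_vars a \<subseteq> K" "\<And>m. m \<in> oc_vars a - K \<Longrightarrow> osub a (?N m) \<subseteq> Y" for Y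
        by (rule OComm.IH(1)[OF wf(1) that _ l(1)]) (use True iK in auto)
      show "osub b (N(m := ?D k)) \<subseteq> Y"
        if "Y \<lhd> G" "\<not> oc_vars b \<subseteq> K" "\<And>m. m \<in> oc_vars b - K \<Longrightarrow> osub b (?N m) \<subseteq> Y"
          "m \<in> oc_vars b \<inter> K" "size b \<le> k" for Y m k
        by (rule OComm.IH(2)[OF wf(2) that])
      show "\<not> oc_vars a \<union> oc_vars b \<subseteq> K" using OComm.prems by simp
    qed
  next
    case False
    then have ib: "i \<in> oc_vars b" using OComm.prems by simp
    have dj': "oc_vars b \<inter> oc_vars a = {}" using dj by blast
    have car: "\<And>m. osub a (?N m) \<subseteq> carrier G" "\<And>m. osub b (?N m) \<subseteq> carrier G"
      by (rule normal_subset, rule osub_normal, rule N')+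
    have hyp': "comm_sub (osub b (?N m)) (osub a (?N m)) \<subseteq> Z"
      if "m \<in> oc_vars b \<union> oc_vars a - K" for m
      using hyp[of m] that unfolding comm_sub_commute[OF car, of m m] by blast
    have "comm_sub (osub b (N(i := ?D l))) (osub a N) \<subseteq> Z"
    proof (rule key[OF _ _ wf(1) dj' _ ib hyp'])
      show "osub b (N(i := ?D l)) \<subseteq> Y"
        if "Y \<lhd> G" "\<not> oc_vars b \<subseteq> K" "\<And>m. m \<in> oc_vars b - K \<Longrightarrow> osub b (?N m) \<subseteq> Y" for Y
        by (rule OComm.IH(2)[OF wf(2) that _ l(2)]) (use ib iK in auto)
      show "osub a (N(m := ?D k)) \<subseteq> Y"
        if "Y \<lhd> G" "\<not> oc_vars a \<subseteq> K" "\<And>m. m \<in> oc_vars a - K \<Longrightarrow> osub a (?N m) \<subseteq> Y"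
          "m \<in> oc_vars a \<inter> K" "size a \<le> k" for Y m k
        by (rule OComm.IH(1)[OF wf(1) that])
      show "\<not> oc_vars b \<union> oc_vars a \<subseteq> K" using OComm.prems by auto
      show "size b + size a < l" using l by simp
    qed
    moreover have "osub b (N(i := ?D l)) \<subseteq> carrier G" "osub a N \<subseteq> carrier G"
      by (rule normal_subset, rule osub_normal, rule N'' N)+
    ultimately show ?thesis
      unfolding osub.simps osub_upd_notin[OF False] using comm_sub_commute by simp
  qed
qed

end

subsection \<open>Finitely many values\<close>

lemma finite_oc_vars [simp]: "finite (oc_vars t)"
  by (induction t) auto

lemma oc_vars_nonempty [simp]: "oc_vars t \<noteq> {}"
  by (induction t) auto

context group
begin

lemma normal_INT:
  assumes "K \<noteq> {}" "\<And>m. m \<in> K \<Longrightarrow> N m \<lhd> G"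
  shows "(\<Inter>m\<in>K. N m) \<lhd> G"
proof (rule normalI_conj)
  show "subgroup (\<Inter>m\<in>K. N m) G"
    using assms by (intro subgroups_Inter) (auto simp: normal_imp_subgroup)
qed (use assms normal_conj in blast)

lemma generate_subgroup_eq: "subgroup H G \<Longrightarrow> generate G H = H"
  using generate_subgroup_incl[of H H] by (auto intro: generate.incl)

end

text \<open>The set \<open>T\<close> plays the role of the torsion part of the iterated commutator subgroup:
  modulo \<open>T\<close> that subgroup is abelian and torsion-free.\<close>

locale oc_finite_values = group G for G (structure) +
  fixes t :: oc and S :: "nat \<Rightarrow> 'a set" and e :: "nat \<Rightarrow> nat" and T :: "'a set"
  assumes wf: "oc_wf t"
    and S: "\<And>m. conj_closed (S m)"
    and e_pos: "\<And>m. m \<in> oc_vars t \<Longrightarrow> 0 < e m"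
    and pow_in_S: "\<And>m g. m \<in> oc_vars t \<Longrightarrow> g \<in> generate G (S m) \<Longrightarrow> g [^] e m \<in> S m"
    and fin: "finite {oval t x | x. \<forall>m\<in>oc_vars t. x m \<in> S m}"
    and T: "T \<lhd> G"
    and abelian: "comm_sub (osub t (\<lambda>m. generate G (S m))) (osub t (\<lambda>m. generate G (S m))) \<subseteq> T"
    and torsion_free: "\<And>x n. x \<in> osub t (\<lambda>m. generate G (S m)) \<Longrightarrow> 0 < n \<Longrightarrow> x [^] (n::nat) \<in> T \<Longrightarrow> x \<in> T"
begin

definition N :: "nat \<Rightarrow> 'a set" where
  "N m = generate G (S m)"

lemma N_normal: "N m \<lhd> G"
  unfolding N_def by (rule generate_conj_closed_normal[OF S])

lemma N_eq: "N = (\<lambda>m. generate G (S m))"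
  by (intro ext) (rule N_def)

lemma S_subset_N: "S m \<subseteq> N m"
  unfolding N_def by (auto intro: generate.incl)

text \<open>\<open>h1\<close> and \<open>h2\<close> make the word compatible with powers modulo
  \<open>T\<close> in every entry from \<open>I\<close>. A value outside \<open>T\<close> would then
  have infinitely many powers, distinct modulo \<open>T\<close>, represented by the finitely many
  values in \<open>fin\<close>.\<close>

lemma linear_labels_trivial:
  assumes A: "A \<lhd> G" and I: "I \<subseteq> oc_vars t" "I \<noteq> {}" and AN: "\<And>m. m \<in> I \<Longrightarrow> A \<subseteq> N m"
    and M_def: "M = (\<lambda>m. if m \<in> I then A else N m)"
    and h1: "\<And>m. m \<in> I \<Longrightarrow> osub t (M(m := comm_sub A A)) \<subseteq> T"
    and h2: "\<And>m. m \<in> oc_vars t - I \<Longrightarrow> osub t (M(m := comm_sub A (N m))) \<subseteq> T"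
  shows "osub t M \<subseteq> T"
proof -
  have M: "M m \<lhd> G" for m using A N_normal by (simp add: M_def)
  define S' where "S' = (\<lambda>m. if m \<in> I then A else S m)"
  have S': "conj_closed (S' m)" for m using S normal_conj_closed[OF A] by (simp add: S'_def)
  have MS': "M = (\<lambda>m. generate G (S' m))"
    using generate_subgroup_eq[OF normal_imp_subgroup[OF A]]
    by (intro ext) (auto simp: M_def S'_def N_def)
  have sT: "subgroup T G" by (rule normal_imp_subgroup[OF T])
  have lin: "T #> oval t (x(i := y [^] n)) = T #> oval t (x(i := y)) [^] n"
    if i: "i \<in> I" and y: "y \<in> A" and x: "\<And>m. m \<in> oc_vars t \<Longrightarrow> x m \<in> M m" for x i y and n :: nat
  proof (rule oval_pow_mod[of M, OF M _ wf T _ x])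
    show "y \<in> M i" "i \<in> oc_vars t" using i y I by (auto simp: M_def)
    fix m assume m: "m \<in> oc_vars t - {i}"
    show "osub t (M(m := comm_sub (M i) (M m))) \<subseteq> T"
      using h1[of m] h2[of m] m i by (cases "m \<in> I") (simp_all add: M_def)
  qed
  have "oval t x \<in> T" if x: "\<And>m. m \<in> oc_vars t \<Longrightarrow> x m \<in> S' m" for x
  proof -
    have xA: "x m \<in> A" if "m \<in> I" for m using x[of m] that I by (auto simp: S'_def)
    have xN: "x m \<in> N m" if "m \<in> oc_vars t" for m
      using x[OF that] AN S_subset_N by (auto simp: S'_def split: if_splits)
    have xM: "x m \<in> M m" if "m \<in> oc_vars t" for m
      using x[OF that] S_subset_N by (auto simp: S'_def M_def split: if_splits)
    have xc: "x m \<in> carrier G" if "m \<in> oc_vars t" for m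
      using xN[OF that] N_normal normal_subset by blast
    \<comment> \<open>Entries from \<open>I\<close> range over \<open>A\<close>, not over
      \<open>S m\<close>. Raising all of them to the powers \<open>e m\<close> gives an assignment
      in \<open>S\<close> and, modulo \<open>T\<close>, replaces the value by a positive power of
      itself.\<close>
    define y where "y J m = (if m \<in> J then x m [^] e m else x m)" for J m
    have yM: "y J m \<in> M m" if "m \<in> oc_vars t" for J m
      using xM[OF that] M[of m] by (simp add: y_def normal_imp_subgroup subgroup_nat_pow_closed)
    have yc: "y J m \<in> carrier G" if "m \<in> oc_vars t" for J m
      using yM[OF that] M normal_subset by blast
    have vc: "oval t x \<in> carrier G" "oval t (y J) \<in> carrier G" for J
      using xc yc by (auto intro!: oval_closed)
    have "\<exists>c::nat. c > 0 \<and> T #> oval t (y J) = T #> oval t x [^] c" if "finite J" "J \<subseteq> I" for J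
      using that
    proof (induction J)
      case empty
      then show ?case using vc by (intro exI[of _ 1]) (auto simp: y_def)
    next
      case (insert j J)
      then obtain c :: nat where c: "c > 0" "T #> oval t (y J) = T #> oval t x [^] c" by blast
      have eq: "y (insert j J) = (y J)(j := x j [^] e j)" "(y J)(j := x j) = y J"
        using insert.hyps by (auto simp: y_def)
      have "T #> oval t (y (insert j J)) = T #> oval t (y J) [^] e j"
        using lin[of j "x j" "y J" "e j"] insert.prems xA yM unfolding eq by simp
      also have "\<dots> = T #> (oval t x [^] c) [^] e j"
        using vc c by (intro rcoset_pow[OF T]) auto
      also have "\<dots> = T #> oval t x [^] (c * e j)" using vc by (simp add: nat_pow_pow)
      finally show ?case using c(1) e_pos[of j] insert.prems I by (intro exI[of _ "c * e j"]) auto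
    qed
    from this[OF finite_subset[OF I(1) finite_oc_vars] subset_refl]
    obtain c :: nat where c: "c > 0" "T #> oval t (y I) = T #> oval t x [^] c" by blast
    obtain i where i: "i \<in> I" using I by blast
    let ?v = "oval t (y I)"
    \<comment> \<open>These represent all powers of \<open>?v\<close> modulo \<open>T\<close>. They
      are still values on \<open>S\<close>, because (x^e)^n = (x^n)^e is an \<open>e i\<close>-th
      power of an element of \<open>N i\<close>.\<close>
    let ?w = "\<lambda>n::nat. oval t ((y I)(i := (x i [^] e i) [^] n))"
    have w: "T #> ?w n = T #> ?v [^] n" for n
    proof -
      have "(y I)(i := x i [^] e i) = y I" using i by (auto simp: y_def)
      then show ?thesis
        using lin[of i "x i [^] e i" "y I" n] i xA yM A
        by (simp add: normal_imp_subgroup subgroup_nat_pow_closed)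
    qed
    have yS: "y I m \<in> S m" if "m \<in> oc_vars t" for m
      using pow_in_S[OF that] xN[OF that] x[OF that] by (auto simp: y_def S'_def N_def split: if_splits)
    have "(x i [^] e i) [^] n \<in> S i" for n :: nat
    proof -
      have it: "i \<in> oc_vars t" using i I by blast
      have "(x i [^] n) [^] e i \<in> S i"
        using xN[OF it] N_normal[of i]
        by (intro pow_in_S[OF it]) (simp add: N_def normal_imp_subgroup subgroup_nat_pow_closed)
      then show ?thesis using xc[OF it] by (simp add: nat_pow_pow mult.commute)
    qed
    then have "?w n \<in> {oval t x | x. \<forall>m\<in>oc_vars t. x m \<in> S m}" for n
      using yS by auto
    then obtain a b where ab: "a < b" "?w a = ?w b"
      using not_inj_nat_finite[OF fin, of ?w] by blast
    then have "T #> ?v [^] b = T #> ?v [^] a" using w[of a] w[of b] by simp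
    then obtain z where z: "z \<in> T" "?v [^] b = z \<otimes> ?v [^] a"
      using rcoset_eqD[OF sT nat_pow_closed[OF vc(2)]] by blast
    have zc: "z \<in> carrier G" using z(1) T normal_subset by blast
    have "?v [^] b = ?v [^] (b - a) \<otimes> ?v [^] a"
      using ab vc by (simp add: nat_pow_mult)
    then have "?v [^] (b - a) = z" using z zc vc by (simp add: r_cancel)
    then have "?v [^] (b - a) \<in> T" using z by simp
    moreover have "?v \<in> osub t (\<lambda>m. generate G (S m))"
      using yS by (intro oval_in_osub) (auto intro: generate.incl)
    ultimately have "?v \<in> T" using torsion_free ab by (metis zero_less_diff)
    then have "T #> ?v = T" using rcoset_one_iff[OF sT vc(2)[of I]] by (rule iffD2[rotated])
    then have "T #> oval t x [^] c = T" unfolding c(2) .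
    then have "oval t x [^] c \<in> T" using rcoset_one_iff[OF sT nat_pow_closed[OF vc(1)]] by simp
    moreover have "oval t x \<in> osub t (\<lambda>m. generate G (S m))"
      using xN by (intro oval_in_osub) (auto simp: N_def)
    ultimately show ?thesis using torsion_free c(1) by blast
  qed
  then show ?thesis unfolding MS' by (rule osub_generate_subset[OF S' wf T])
qed

text \<open>One step up the derived series, from \<open>comm_sub B B\<close> to \<open>B\<close>.
  The set \<open>I\<close> of entries labelled \<open>B\<close> shrinks from \<open>K\<close> to a
  single index.\<close>

lemma derived_step:
  assumes B: "B \<lhd> G" and K: "K \<subseteq> oc_vars t" and BN: "\<And>m. m \<in> K \<Longrightarrow> B \<subseteq> N m"
    and out: "\<And>m. m \<in> oc_vars t - K \<Longrightarrow> osub t (N(m := comm_sub B (N m))) \<subseteq> T"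
    and der: "\<And>m. m \<in> K \<Longrightarrow> osub t (N(m := comm_sub B B)) \<subseteq> T"
    and i: "i \<in> K"
  shows "osub t (N(i := B)) \<subseteq> T"
proof -
  define M where "M I m = (if m \<in> I then B else N m)" for I m
  have MN: "M I m \<subseteq> N m" if "I \<subseteq> K" for I m using BN that by (auto simp: M_def)
  have upd: "osub t ((M I)(m := C)) \<subseteq> osub t (N(m := C))" if "I \<subseteq> K" for I m C
    using MN[OF that] by (intro osub_mono) auto
  have "osub t (M I) \<subseteq> T" if "I \<subseteq> K" "I \<noteq> {}" for I
    using that
  proof (induction "card (K - I)" arbitrary: I rule: less_induct)
    case less
    have fK: "finite K" using finite_subset[OF K] by simp
    show ?case
    proof (rule linear_labels_trivial[OF B _ less.prems(2) _ ext[of "M I"]])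
      show "I \<subseteq> oc_vars t" using less K by blast
      show "B \<subseteq> N m" if "m \<in> I" for m using BN that less by blast
      show "M I m = (if m \<in> I then B else N m)" for m by (simp add: M_def)
      show "osub t ((M I)(m := comm_sub B B)) \<subseteq> T" if "m \<in> I" for m
        using upd[of I m "comm_sub B B"] der[of m] that less.prems by blast
      fix m assume m: "m \<in> oc_vars t - I"
      show "osub t ((M I)(m := comm_sub B (N m))) \<subseteq> T"
      proof (cases "m \<in> K")
        case True
        \<comment> \<open>As [B,N_m] lies in \<open>B\<close>, this is covered by the case of the
          larger set \<open>insert m I\<close>.\<close>
        have "osub t ((M I)(m := comm_sub B (N m))) \<subseteq> osub t (M (insert m I))"
          using comm_sub_subset_left[OF B normal_subset[OF N_normal]]
          by (intro osub_mono) (auto simp: M_def)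
        also have "\<dots> \<subseteq> T"
          using True m less.prems fK by (intro less.hyps psubset_card_mono) auto
        finally show ?thesis .
      next
        case False
        then show ?thesis using upd[of I m "comm_sub B (N m)"] out[of m] m less.prems by blast
      qed
    qed
  qed
  from this[of "{i}"] have "osub t (M {i}) \<subseteq> T" using i by blast
  moreover have "M {i} = N(i := B)" by (auto simp: M_def)
  ultimately show ?thesis by simp
qed

lemma INT_label_trivial:
  "K \<subseteq> oc_vars t \<Longrightarrow> i \<in> K \<Longrightarrow> osub t (N(i := (\<Inter>m\<in>K. N m))) \<subseteq> T"
proof (induction "card (oc_vars t - K)" arbitrary: K i rule: less_induct)
  case less
  define D where "D = (\<Inter>m\<in>K. N m)"
  have D: "D \<lhd> G" unfolding D_def using less.prems N_normal by (intro normal_INT) auto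
  let ?D = "\<lambda>l. derived_iter l D"
  have Dl: "?D l \<lhd> G" for l by (rule derived_iter_normal[OF D])
  have DD: "?D l \<subseteq> D" for l using derived_iter_antimono[OF D, of 0 l] by simp
  have DN: "D \<subseteq> N m" if "m \<in> K" for m using that by (auto simp: D_def)
  \<comment> \<open>[D,N_m] lies in the intersection of \<open>D\<close> and \<open>N m\<close>,
    which is the subgroup belonging to \<open>insert m K\<close>; the downward induction on
    \<open>K\<close> applies.\<close>
  have out: "osub t (N(m := comm_sub D (N m))) \<subseteq> T" if m: "m \<in> oc_vars t - K" for m
  proof -
    have "comm_sub D (N m) \<subseteq> D" "comm_sub D (N m) \<subseteq> N m"
      by (rule comm_sub_subset_left[OF D normal_subset[OF N_normal]],
          rule comm_sub_subset_right[OF normal_subset[OF D] N_normal])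
    then have "osub t (N(m := comm_sub D (N m))) \<subseteq> osub t (N(m := (\<Inter>m\<in>insert m K. N m)))"
      by (intro osub_mono) (auto simp: D_def)
    also have "\<dots> \<subseteq> T"
      using m less.prems by (intro less.hyps psubset_card_mono) auto
    finally show ?thesis .
  qed
  have "\<exists>l. \<forall>j\<in>K. osub t (N(j := ?D l)) \<subseteq> T"
  proof (cases "oc_vars t \<subseteq> K")
    case True
    \<comment> \<open>When \<open>K\<close> contains all variables there is no label outside
      \<open>K\<close> to use. Instead a derived term of \<open>D\<close> lies in
      \<open>osub t N\<close>, and one further derived step leads into \<open>T\<close> by
      \<open>abelian\<close>.\<close>
    have "?D (size t) \<subseteq> osub t N"
      using DN True by (intro derived_iter_subset_osub[OF D]) auto
    then have "?D (Suc (size t)) \<subseteq> comm_sub (osub t N) (osub t N)"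
      unfolding derived_iter.simps by (intro comm_sub_mono)
    also have "\<dots> \<subseteq> T" using abelian by (simp add: N_eq)
    finally have 1: "?D (Suc (size t)) \<subseteq> T" .
    have 2: "osub t (N(j := ?D l)) \<subseteq> ?D l" if "j \<in> K" for j l
    proof -
      have "osub t (N(j := ?D l)) \<subseteq> (N(j := ?D l)) j"
        using that N_normal Dl less.prems(1) by (intro osub_subset_label) auto
      then show ?thesis by simp
    qed
    show ?thesis
    proof (intro exI ballI)
      show "osub t (N(j := ?D (Suc (size t)))) \<subseteq> T" if "j \<in> K" for j
        using 2[OF that, of "Suc (size t)"] 1 by (rule subset_trans)
    qed
  next
    case False
    have "osub t (N(j := ?D (size t))) \<subseteq> T" if "j \<in> K" for j
      using that less.prems
      by (intro osub_derived_iter_subset[of N, OF N_normal D DN wf T False out]) auto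
    then show ?thesis by blast
  qed
  then obtain l where "\<forall>j\<in>K. osub t (N(j := ?D l)) \<subseteq> T" by blast
  \<comment> \<open>Climb from depth \<open>l\<close> back to depth 0, where the derived term is
    \<open>D\<close> itself.\<close>
  then have "\<forall>j\<in>K. osub t (N(j := ?D 0)) \<subseteq> T"
  proof (induction l)
    case (Suc l)
    have "osub t (N(j := ?D l)) \<subseteq> T" if "j \<in> K" for j
    proof (rule derived_step[OF Dl less.prems(1) _ _ _ that])
      show "?D l \<subseteq> N m" if "m \<in> K" for m using DD DN that by blast
      show "osub t (N(m := comm_sub (?D l) (N m))) \<subseteq> T" if "m \<in> oc_vars t - K" for m
      proof -
        have "osub t (N(m := comm_sub (?D l) (N m))) \<subseteq> osub t (N(m := comm_sub D (N m)))"
          using comm_sub_mono[OF DD subset_refl] by (intro osub_mono) auto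
        then show ?thesis using out[OF that] by blast
      qed
      show "osub t (N(m := comm_sub (?D l) (?D l))) \<subseteq> T" if "m \<in> K" for m
        using Suc.prems that unfolding derived_iter.simps by blast
    qed
    then show ?case by (intro Suc.IH) blast
  qed blast
  then show ?case using less.prems by (simp add: D_def)
qed

theorem osub_trivial: "osub t (\<lambda>m. generate G (S m)) \<subseteq> T"
proof -
  obtain i where "i \<in> oc_vars t" using oc_vars_nonempty[of t] by blast
  \<comment> \<open>For a singleton the intersection is \<open>N i\<close>, so no label
    changes.\<close>
  then have "osub t (N(i := (\<Inter>m\<in>{i}. N m))) \<subseteq> T" by (intro INT_label_trivial) auto
  then show ?thesis by (simp add: N_eq[symmetric])
qed

end

subsection \<open>Words\<close>

context group
begin

section \<open>Evaluation of words and the values of the substituted word\<close>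

lemma word_eval_Nil [simp]: "word_eval G f [] = \<one>"
  by (simp add: word_eval_def)

lemma word_eval_Cons [simp]:
  "word_eval G f ((x, b) # w) = (if b then inv (f x) else f x) \<otimes> word_eval G f w"
  by (simp add: word_eval_def)

lemma word_eval_closed: "(\<And>j. f j \<in> carrier G) \<Longrightarrow> word_eval G f w \<in> carrier G"
  by (induction w) auto

lemma word_eval_append:
  assumes "\<And>j. f j \<in> carrier G"
  shows "word_eval G f (v @ w) = word_eval G f v \<otimes> word_eval G f w"
  using assms by (induction v) (auto simp: m_assoc word_eval_closed)

lemma word_eval_inv:
  assumes "\<And>j. f j \<in> carrier G"
  shows "word_eval G f (word_inv w) = inv (word_eval G f w)"
  using assms
  by (induction w) (auto simp: word_inv_def word_eval_append word_eval_closed inv_mult_group)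

lemma word_eval_subst:
  assumes "\<And>j. f j \<in> carrier G"
  shows "word_eval G f (word_subst u w) = word_eval G (\<lambda>j. word_eval G f (u j)) w"
  using assms
  by (induction w) (auto simp: word_subst_def word_eval_append word_eval_inv word_eval_closed)

lemma word_eval_oc_word:
  assumes "\<And>j. f j \<in> carrier G"
  shows "word_eval G f (oc_word t) = oval t f"
  using assms
  by (induction t)
    (auto simp: word_comm_def word_eval_append word_eval_inv oval_closed gcomm_def m_assoc)

lemma word_eval_cong:
  "(\<And>j. j \<in> word_vars w \<Longrightarrow> f j = g j) \<Longrightarrow> word_eval G f w = word_eval G g w"
  by (induction w) (auto simp: word_vars_def)

lemma conj_word_eval:
  assumes "\<And>j. f j \<in> carrier G" "g \<in> carrier G"
  shows "inv g \<otimes> word_eval G f w \<otimes> g = word_eval G (\<lambda>j. inv g \<otimes> f j \<otimes> g) w"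
proof (induction w)
  case Nil
  then show ?case using assms by simp
next
  case (Cons a w)
  obtain x b where a: "a = (x, b)" by (cases a)
  let ?y = "if b then inv (f x) else f x"
  have y: "?y \<in> carrier G" using assms by simp
  have c: "word_eval G f w \<in> carrier G" using assms word_eval_closed by blast
  have "inv g \<otimes> (?y \<otimes> word_eval G f w) \<otimes> g = (inv g \<otimes> ?y \<otimes> g) \<otimes> (inv g \<otimes> word_eval G f w \<otimes> g)"
    using y c assms(2) by (simp add: m_assoc)
  also have "inv g \<otimes> ?y \<otimes> g = (if b then inv (inv g \<otimes> f x \<otimes> g) else inv g \<otimes> f x \<otimes> g)"
    using assms by (simp add: inv_mult_group m_assoc)
  finally show ?case using Cons a by simp
qed

lemma word_values_conj_closed: "conj_closed (word_values G w)"
  unfolding conj_closed_def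
proof (intro conjI ballI)
  show "word_values G w \<subseteq> carrier G"
    unfolding word_values_def using word_eval_closed by (auto simp: Pi_iff)
  fix x g assume "x \<in> word_values G w" and g: "g \<in> carrier G"
  then obtain f where f: "x = word_eval G f w" "\<And>j. f j \<in> carrier G"
    unfolding word_values_def by auto
  have "inv g \<otimes> x \<otimes> g = word_eval G (\<lambda>j. inv g \<otimes> f j \<otimes> g) w"
    unfolding f(1) by (rule conj_word_eval[OF f(2) g])
  moreover have "(\<lambda>j. inv g \<otimes> f j \<otimes> g) \<in> UNIV \<rightarrow> carrier G" using f g by auto
  ultimately show "inv g \<otimes> x \<otimes> g \<in> word_values G w" unfolding word_values_def by blast
qed

lemma word_eval_single:
  assumes "g \<in> carrier G"
  shows "word_eval G (\<lambda>j. if j = k then g else \<one>) w = g [^] exp_sum w k"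
proof (induction w)
  case Nil
  then show ?case by (simp add: exp_sum_def)
next
  case (Cons a w)
  obtain x b where a: "a = (x, b)" by (cases a)
  have e: "exp_sum (a # w) k = (if x = k then (if b then -1 else 1) else 0) + exp_sum w k"
    by (simp add: exp_sum_def a)
  show ?case
    unfolding e unfolding a using Cons assms by (auto simp: int_pow_mult int_pow_neg)
qed

text \<open>Put \<open>g\<close> for a variable with nonzero exponent sum and the identity for all
  others. A negative exponent sum is handled by substituting \<open>inv g\<close>.\<close>

lemma non_commutator_pow_values:
  assumes "non_commutator w"
  shows "\<exists>e>0. \<forall>g\<in>carrier G. g [^] (e::nat) \<in> word_values G w"
proof -
  obtain k where k: "exp_sum w k \<noteq> 0" using assms by (auto simp: non_commutator_def)
  have v: "g [^] exp_sum w k \<in> word_values G w" if "g \<in> carrier G" for g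
  proof -
    have "(\<lambda>j. if j = k then g else \<one>) \<in> UNIV \<rightarrow> carrier G" using that by auto
    then show ?thesis
      unfolding word_values_def using word_eval_single[OF that, of k w, symmetric] by blast
  qed
  have "g [^] nat \<bar>exp_sum w k\<bar> \<in> word_values G w" if g: "g \<in> carrier G" for g
  proof (cases "exp_sum w k > 0")
    case True
    then show ?thesis using v[OF g] by (simp add: pow_nat)
  next
    case False
    have "inv g [^] exp_sum w k = g [^] (- exp_sum w k)"
      using g by (simp add: int_pow_inv int_pow_neg)
    also have "\<dots> = g [^] nat \<bar>exp_sum w k\<bar>" using False by (simp add: pow_nat)
    finally show ?thesis using v[of "inv g"] g by simp
  qed
  then show ?thesis using k by (intro exI[of _ "nat \<bar>exp_sum w k\<bar>"]) auto
qed

text \<open>Because the words \<open>u m\<close> share no variables, their values can be prescribed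
  independently of each other.\<close>

lemma word_values_subst_oc_word:
  assumes "\<forall>i\<in>oc_vars t. \<forall>j\<in>oc_vars t. i \<noteq> j \<longrightarrow> word_vars (u i) \<inter> word_vars (u j) = {}"
  shows "word_values G (word_subst u (oc_word t)) =
    {oval t x | x. \<forall>m\<in>oc_vars t. x m \<in> word_values G (u m)}"
proof (intro equalityI subsetI)
  fix v assume "v \<in> word_values G (word_subst u (oc_word t))"
  then obtain f where f: "f \<in> UNIV \<rightarrow> carrier G" "v = word_eval G f (word_subst u (oc_word t))"
    unfolding word_values_def by blast
  have fc: "\<And>j. f j \<in> carrier G" using f(1) by auto
  have "v = oval t (\<lambda>j. word_eval G f (u j))"
    unfolding f(2) by (simp add: word_eval_subst word_eval_oc_word word_eval_closed fc)
  moreover have "\<forall>m\<in>oc_vars t. word_eval G f (u m) \<in> word_values G (u m)"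
    unfolding word_values_def using f(1) by blast
  ultimately show "v \<in> {oval t x | x. \<forall>m\<in>oc_vars t. x m \<in> word_values G (u m)}" by blast
next
  fix v assume "v \<in> {oval t x | x. \<forall>m\<in>oc_vars t. x m \<in> word_values G (u m)}"
  then obtain x where x: "v = oval t x" "\<forall>m\<in>oc_vars t. x m \<in> word_values G (u m)" by blast
  then have "\<forall>m\<in>oc_vars t. \<exists>f. f \<in> UNIV \<rightarrow> carrier G \<and> x m = word_eval G f (u m)"
    unfolding word_values_def by blast
  from bchoice[OF this] obtain f
    where f: "\<And>m. m \<in> oc_vars t \<Longrightarrow> f m \<in> UNIV \<rightarrow> carrier G \<and> x m = word_eval G (f m) (u m)"
    by blast
  \<comment> \<open>Glues the assignments \<open>f m\<close>: the index selected by
    \<open>SOME\<close> is unique by disjointness, and variables occurring in none of the words are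
    sent to the identity.\<close>
  define F where "F j = (if \<exists>m\<in>oc_vars t. j \<in> word_vars (u m)
    then f (SOME m. m \<in> oc_vars t \<and> j \<in> word_vars (u m)) j else \<one>)" for j
  have F: "F j = f m j" if m: "m \<in> oc_vars t" "j \<in> word_vars (u m)" for m j
  proof -
    have "(SOME m. m \<in> oc_vars t \<and> j \<in> word_vars (u m)) = m"
      using m assms by (intro some_equality) blast+
    then show ?thesis using m by (auto simp: F_def)
  qed
  have Fc: "F j \<in> carrier G" for j
  proof (cases "\<exists>m\<in>oc_vars t. j \<in> word_vars (u m)")
    case True
    then obtain m where m: "m \<in> oc_vars t" "j \<in> word_vars (u m)" by blast
    then show ?thesis using F[OF m] f[OF m(1)] by auto
  qed (simp add: F_def)
  have "word_eval G F (u m) = x m" if "m \<in> oc_vars t" for m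
    using f[OF that] F[OF that] word_eval_cong[of "u m" F "f m"] by simp
  then have "v = oval t (\<lambda>m. word_eval G F (u m))" unfolding x(1) by (intro oval_cong) simp
  also have "\<dots> = word_eval G F (word_subst u (oc_word t))"
    by (simp add: word_eval_subst word_eval_oc_word word_eval_closed Fc)
  finally show "v \<in> word_values G (word_subst u (oc_word t))"
    unfolding word_values_def using Fc by blast
qed

end

text \<open>The group is arbitrary, over any type, which expresses conciseness. Powers of the
  variables with nonzero exponents are the special case where \<open>u i\<close> repeats one letter
  in the variable i.\<close>

theorem theoremA:
  fixes t :: oc and u :: "nat \<Rightarrow> word" and G :: "('g, 'm) monoid_scheme"
  assumes "oc_wf t"
    and "\<forall>i\<in>oc_vars t. reduced (u i) \<and> non_commutator (u i)"
    and "\<forall>i\<in>oc_vars t. \<forall>j\<in>oc_vars t. i \<noteq> j \<longrightarrow> word_vars (u i) \<inter> word_vars (u j) = {}"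
    and "group G"
  shows "concise_in G (word_subst u (oc_word t))"
  unfolding concise_in_def
proof
  interpret group G by fact
  let ?V = "word_values G (word_subst u (oc_word t))"
  let ?W = "generate G ?V"
  let ?S = "\<lambda>m. word_values G (u m)"
  let ?N = "\<lambda>m. generate G (?S m)"
  assume finV: "finite ?V"
  have V: "conj_closed ?V" by (rule word_values_conj_closed)
  have V_eq: "?V = {oval t x | x. \<forall>m\<in>oc_vars t. x m \<in> ?S m}"
    by (rule word_values_subst_oc_word[OF assms(3)])
  have "\<forall>m\<in>oc_vars t. \<exists>e>0. \<forall>g\<in>carrier G. g [^]\<^bsub>G\<^esub> (e::nat) \<in> ?S m"
    using assms(2) non_commutator_pow_values by blast
  from bchoice[OF this] obtain e :: "nat \<Rightarrow> nat"
    where e: "\<And>m. m \<in> oc_vars t \<Longrightarrow> e m > 0 \<and> (\<forall>g\<in>carrier G. g [^]\<^bsub>G\<^esub> e m \<in> ?S m)"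
    by blast
  have W: "?W \<lhd> G" by (rule generate_conj_closed_normal[OF V])
  have "oval t x \<in> ?W" if "\<And>m. m \<in> oc_vars t \<Longrightarrow> x m \<in> ?S m" for x
  proof -
    have "oval t x \<in> ?V" unfolding V_eq using that by blast
    then show ?thesis by (rule generate.incl)
  qed
  \<comment> \<open>This inclusion lets the facts about \<open>?W\<close> and its torsion part
    (commutators are torsion, torsion-free quotient) be used for \<open>osub t ?N\<close>.\<close>
  then have sub: "osub t ?N \<subseteq> ?W"
    by (rule osub_generate_subset[OF word_values_conj_closed assms(1) W])
  interpret oc_finite_values G t ?S e "torsion_part ?W"
  proof (intro oc_finite_values.intro oc_finite_values_axioms.intro)
    show "group G" by fact
    show "oc_wf t" by fact
    show "conj_closed (?S m)" for m by (rule word_values_conj_closed)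
    show "0 < e m" if "m \<in> oc_vars t" for m using e[OF that] by blast
    show "g [^]\<^bsub>G\<^esub> e m \<in> ?S m" if "m \<in> oc_vars t" "g \<in> ?N m" for m g
      using e[OF that(1)] that(2) normal_subset[OF generate_conj_closed_normal[OF word_values_conj_closed]]
      by blast
    show "finite {oval t x | x. \<forall>m\<in>oc_vars t. x m \<in> ?S m}" using finV unfolding V_eq .
    show "torsion_part ?W \<lhd> G" by (rule torsion_part_normal[OF finV V refl])
    show "comm_sub (osub t ?N) (osub t ?N) \<subseteq> torsion_part ?W"
      using comm_sub_mono[OF sub sub] commutators_torsion[OF finV V refl] by blast
    show "x \<in> torsion_part ?W"
      if "x \<in> osub t ?N" "0 < n" "x [^]\<^bsub>G\<^esub> n \<in> torsion_part ?W" for x and n :: nat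
      using torsion_part_isolated[OF finV V refl] sub that by blast
  qed
  \<comment> \<open>Every generator of \<open>?W\<close> is thus torsion by
    \<open>osub_trivial\<close>, and Dietzmann's theorem makes \<open>?W\<close> finite.\<close>
  have "?V \<subseteq> osub t ?N"
  proof
    fix v assume "v \<in> ?V"
    then obtain x where "v = oval t x" "\<forall>m\<in>oc_vars t. x m \<in> ?S m" unfolding V_eq by blast
    then show "v \<in> osub t ?N" by (auto intro!: oval_in_osub intro: generate.incl)
  qed
  then have "?V \<subseteq> torsion_part ?W" using osub_trivial by blast
  then show "finite ?W" by (rule finite_if_torsion[OF finV V refl])
qed

end
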